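(* Let $\mathcal{M}$ be an irreducible trace monoid and $\mathbb{P}$ a Bernoulli measure on $(\mathcal{B}\mathcal{M},\mathfrak{F})$. For every bounded Möbius harmonic function $\lambda:\mathcal{M}\to\mathbb{R}$ there exists a unique $\varphi\in L^\infty(\mathcal{B}\mathcal{M})$ such that \[ \lambda(u)=\frac{1}{\mathbb{P}(\uparrow u)}\int_{\uparrow u}\varphi\,d\mathbb{P}\qquad\text{for all }u\in\mathcal{M}. \] This formula establishes a bijective, isometric, linear correspondence between $L^\infty(\mathcal{B}\mathcal{M})$ (with the essential sup norm) and the space of bounded Möbius harmonic functions on $\mathcal{M}$ (with the sup norm), and both this correspondence and its inverse are positive operators.
   Context: Let $\Sigma$ be a finite alphabet with $|\Sigma|>1$ and $I\subseteq\Sigma\times\Sigma$ a symmetric irreflexive relation. The trace monoid $\mathcal{M}=\mathcal{M}(\Sigma,I)$ is the quotient of $\Sigma^*$ by the congruence generated by $(ab,ba)$ for $(a,b)\in I$; product $\cdot$, identity $0$. It is irreducible if the graph $(\Sigma,D)$, $D=(\Sigma\times\Sigma)\setminus I$, is connected. Prefix order: $u\leq v$ iff $v=u\cdot w$ for some $w$. A clique is a subset $c\subseteq\Sigma$ whose distinct elements are pairwise related by $I$ (including the empty clique $0$), identified with the product of its letters in $\mathcal{M}$; $\mathscr{C}$ is the set of cliques and $|c|$ its cardinality. Boundary: let $\mathcal{H}$ be the set of sequences $(x_n)_{n\ge0}$ in $\mathcal{M}$ with $x_n\leq x_{n+1}$, preordered by $x\preccurlyeq y$ iff for all $n$ there is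 $m$ with $x_n\leq y_m$; $\overline{\mathcal{M}}$ is the quotient by $x\preccurlyeq y\wedge y\preccurlyeq x$ with the induced partial order $\leq$; $\mathcal{M}$ embeds via constant sequences and $\mathcal{B}\mathcal{M}=\overline{\mathcal{M}}\setminus\mathcal{M}$ (infinite traces). For $u\in\mathcal{M}$, $\uparrow u=\{\xi\in\mathcal{B}\mathcal{M}: u\leq\xi\}$, and $\mathfrak{F}$ is the $\sigma$-algebra generated by these cylinders. A Bernoulli measure is a probability measure $\mathbb{P}$ on $(\mathcal{B}\mathcal{M},\mathfrak{F})$ with $\mathbb{P}(\uparrow u)>0$ for all $u$ and $\mathbb{P}(\uparrow(u\cdot v))=\mathbb{P}(\uparrow u)\mathbb{P}(\uparrow v)$ for all $u,v$. $L^\infty(\mathcal{B}\mathcal{M})$ is the space of $\mathbb{P}$-essentially bounded measurable real functions modulo $\mathbb{P}$-null sets. With $f(u)=\mathbb{P}(\uparrow u)$, a function $\lambda:\mathcal{M}\to\mathbb{R}$ is Möbius harmonic if $\sum_{c\in\mathscr{C}}(-1)^{|c|}f(c)\lambda(u\cdot c)=0$ for all $u\in\mathcal{M}$. *)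

theory Defs
  imports "HOL-Probability.Probability" "HOL-Algebra.Group"
begin

section \<open>Trace monoids\<close>

inductive trace_equiv :: "('a \<times> 'a) set \<Rightarrow> 'a list \<Rightarrow> 'a list \<Rightarrow> bool" for I where
  swap: "(a, b) \<in> I \<Longrightarrow> trace_equiv I [a, b] [b, a]"
| refl: "trace_equiv I u u"
| sym: "trace_equiv I u v \<Longrightarrow> trace_equiv I v u"
| trans: "trace_equiv I u v \<Longrightarrow> trace_equiv I v w \<Longrightarrow> trace_equiv I u w"
| append: "trace_equiv I u u' \<Longrightarrow> trace_equiv I v v' \<Longrightarrow> trace_equiv I (u @ v) (u' @ v')"

definition trace_rel :: "('a \<times> 'a) set \<Rightarrow> ('a list \<times> 'a list) set" where
  "trace_rel I = {(u, v). trace_equiv I u v}"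

definition trace_of :: "('a \<times> 'a) set \<Rightarrow> 'a list \<Rightarrow> 'a list set" where
  "trace_of I w = trace_rel I `` {w}"

definition trace_monoid :: "('a \<times> 'a) set \<Rightarrow> 'a list set monoid" where
  "trace_monoid I =
     \<lparr> carrier = UNIV // trace_rel I,
       monoid.mult = (\<lambda>s t. \<Union>u\<in>s. \<Union>v\<in>t. trace_of I (u @ v)),
       one = trace_of I [] \<rparr>"

definition irreducible_trace_monoid :: "('a \<times> 'a) set \<Rightarrow> bool" where
  "irreducible_trace_monoid I \<longleftrightarrow> (\<forall>a b. (a, b) \<in> (UNIV - I)\<^sup>*)"

definition trace_le :: "('a \<times> 'a) set \<Rightarrow> 'a list set \<Rightarrow> 'a list set \<Rightarrow> bool" where
  "trace_le I u v \<longleftrightarrow> (\<exists>w\<in>carrier (trace_monoid I). v = u \<otimes>\<^bsub>trace_monoid I\<^esub> w)"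

definition cliques :: "('a \<times> 'a) set \<Rightarrow> 'a set set" where
  "cliques I = {c. \<forall>a\<in>c. \<forall>b\<in>c. a \<noteq> b \<longrightarrow> (a, b) \<in> I}"

text \<open>The product of the letters of a clique does not depend on the enumeration of the
  letters; this is proved in \<open>clique_trace_eq\<close> below.\<close>

definition clique_trace :: "('a \<times> 'a) set \<Rightarrow> 'a set \<Rightarrow> 'a list set" where
  "clique_trace I c = (THE t. \<exists>w. distinct w \<and> set w = c \<and> t = trace_of I w)"

section \<open>The boundary\<close>

definition trace_chains :: "('a \<times> 'a) set \<Rightarrow> (nat \<Rightarrow> 'a list set) set" where
  "trace_chains I =
     {x. (\<forall>n. x n \<in> carrier (trace_monoid I)) \<and> (\<forall>n. trace_le I (x n) (x (Suc n)))}"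

definition chain_le ::
    "('a \<times> 'a) set \<Rightarrow> (nat \<Rightarrow> 'a list set) \<Rightarrow> (nat \<Rightarrow> 'a list set) \<Rightarrow> bool" where
  "chain_le I x y \<longleftrightarrow> (\<forall>n. \<exists>m. trace_le I (x n) (y m))"

definition chain_rel ::
    "('a \<times> 'a) set \<Rightarrow> ((nat \<Rightarrow> 'a list set) \<times> (nat \<Rightarrow> 'a list set)) set" where
  "chain_rel I =
     {(x, y). x \<in> trace_chains I \<and> y \<in> trace_chains I \<and> chain_le I x y \<and> chain_le I y x}"

type_synonym 'a gen_trace = "(nat \<Rightarrow> 'a list set) set"

definition gen_traces :: "('a \<times> 'a) set \<Rightarrow> 'a gen_trace set" where
  "gen_traces I = trace_chains I // chain_rel I"

definition gen_trace_le :: "('a \<times> 'a) set \<Rightarrow> 'a gen_trace \<Rightarrow> 'a gen_trace \<Rightarrow> bool" where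
  "gen_trace_le I \<xi> \<eta> \<longleftrightarrow> (\<exists>x\<in>\<xi>. \<exists>y\<in>\<eta>. chain_le I x y)"

definition embed_trace :: "('a \<times> 'a) set \<Rightarrow> 'a list set \<Rightarrow> 'a gen_trace" where
  "embed_trace I u = chain_rel I `` {\<lambda>n. u}"

definition boundary :: "('a \<times> 'a) set \<Rightarrow> 'a gen_trace set" where
  "boundary I = gen_traces I - embed_trace I ` carrier (trace_monoid I)"

definition cylinder :: "('a \<times> 'a) set \<Rightarrow> 'a list set \<Rightarrow> 'a gen_trace set" where
  "cylinder I u = {\<xi> \<in> boundary I. gen_trace_le I (embed_trace I u) \<xi>}"

definition boundary_algebra :: "('a \<times> 'a) set \<Rightarrow> 'a gen_trace set set" where
  "boundary_algebra I = sigma_sets (boundary I) (cylinder I ` carrier (trace_monoid I))"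

definition bernoulli_measure :: "('a \<times> 'a) set \<Rightarrow> 'a gen_trace measure \<Rightarrow> bool" where
  "bernoulli_measure I P \<longleftrightarrow>
     prob_space P \<and> space P = boundary I \<and> sets P = boundary_algebra I \<and>
     (\<forall>u\<in>carrier (trace_monoid I). measure P (cylinder I u) > 0) \<and>
     (\<forall>u\<in>carrier (trace_monoid I). \<forall>v\<in>carrier (trace_monoid I).
        measure P (cylinder I (u \<otimes>\<^bsub>trace_monoid I\<^esub> v))
          = measure P (cylinder I u) * measure P (cylinder I v))"

section \<open>The space of essentially bounded functions\<close>

definition ess_bounded :: "'b measure \<Rightarrow> ('b \<Rightarrow> real) set" where
  "ess_bounded M = {f \<in> borel_measurable M. \<exists>C. AE x in M. \<bar>f x\<bar> \<le> C}"

definition Linf_rel :: "'b measure \<Rightarrow> (('b \<Rightarrow> real) \<times> ('b \<Rightarrow> real)) set" where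
  "Linf_rel M = {(f, g). f \<in> ess_bounded M \<and> g \<in> ess_bounded M \<and> (AE x in M. f x = g x)}"

definition Linf :: "'b measure \<Rightarrow> ('b \<Rightarrow> real) set set" where
  "Linf M = ess_bounded M // Linf_rel M"

definition Linf_add ::
    "'b measure \<Rightarrow> ('b \<Rightarrow> real) set \<Rightarrow> ('b \<Rightarrow> real) set \<Rightarrow> ('b \<Rightarrow> real) set" where
  "Linf_add M \<phi> \<psi> = (\<Union>f\<in>\<phi>. \<Union>g\<in>\<psi>. Linf_rel M `` {\<lambda>x. f x + g x})"

definition Linf_scale :: "'b measure \<Rightarrow> real \<Rightarrow> ('b \<Rightarrow> real) set \<Rightarrow> ('b \<Rightarrow> real) set" where
  "Linf_scale M a \<phi> = (\<Union>f\<in>\<phi>. Linf_rel M `` {\<lambda>x. a * f x})"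

text \<open>In the next two definitions the image is a singleton for \<open>\<phi> \<in> Linf M\<close>
  (and measurable \<open>A\<close>); see \<open>Linf_norm_class\<close> and \<open>Linf_integral_class\<close>.\<close>

definition Linf_norm :: "'b measure \<Rightarrow> ('b \<Rightarrow> real) set \<Rightarrow> real" where
  "Linf_norm M \<phi> = the_elem ((\<lambda>f. real_of_ereal (esssup M (\<lambda>x. ereal \<bar>f x\<bar>))) ` \<phi>)"

definition Linf_integral :: "'b measure \<Rightarrow> 'b set \<Rightarrow> ('b \<Rightarrow> real) set \<Rightarrow> real" where
  "Linf_integral M A \<phi> = the_elem ((\<lambda>f. LINT x:A|M. f x) ` \<phi>)"

definition Linf_nonneg :: "'b measure \<Rightarrow> ('b \<Rightarrow> real) set \<Rightarrow> bool" where
  "Linf_nonneg M \<phi> \<longleftrightarrow> (\<exists>f\<in>\<phi>. AE x in M. 0 \<le> f x)"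

section \<open>Moebius harmonic functions\<close>

definition moebius_harmonic ::
    "('a \<times> 'a) set \<Rightarrow> 'a gen_trace measure \<Rightarrow> ('a list set \<Rightarrow> real) \<Rightarrow> bool" where
  "moebius_harmonic I P h \<longleftrightarrow>
     (\<forall>u\<in>carrier (trace_monoid I).
        (\<Sum>c\<in>cliques I. (- 1) ^ card c * measure P (cylinder I (clique_trace I c))
           * h (u \<otimes>\<^bsub>trace_monoid I\<^esub> clique_trace I c)) = 0)"

text \<open>Functions on the carrier are represented by \<open>extensional\<close> functions, so that
  functions agreeing on the monoid are equal.\<close>

definition bounded_harmonic ::
    "('a \<times> 'a) set \<Rightarrow> 'a gen_trace measure \<Rightarrow> ('a list set \<Rightarrow> real) set" where
  "bounded_harmonic I P =
     {h \<in> extensional (carrier (trace_monoid I)).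
        moebius_harmonic I P h \<and> bounded (h ` carrier (trace_monoid I))}"

definition trace_sup_norm :: "('a \<times> 'a) set \<Rightarrow> ('a list set \<Rightarrow> real) \<Rightarrow> real" where
  "trace_sup_norm I h = (SUP u\<in>carrier (trace_monoid I). \<bar>h u\<bar>)"

definition harmonic_of ::
    "('a \<times> 'a) set \<Rightarrow> 'a gen_trace measure \<Rightarrow> ('a gen_trace \<Rightarrow> real) set
      \<Rightarrow> 'a list set \<Rightarrow> real" where
  "harmonic_of I P \<phi> =
     (\<lambda>u\<in>carrier (trace_monoid I).
        1 / measure P (cylinder I u) * Linf_integral P (cylinder I u) \<phi>)"

section \<open>Well-definedness\<close>

lemma equiv_trace_rel: "equiv UNIV (trace_rel I)"
proof (rule equivI)
  show "trans (trace_rel I)"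
    unfolding trace_rel_def trans_def by (blast intro: trace_equiv.trans)
  show "sym (trace_rel I)"
    unfolding trace_rel_def sym_def by (blast intro: trace_equiv.sym)
qed (simp_all add: trace_rel_def refl_on_def trace_equiv.refl)

lemma trace_of_eq_iff: "trace_of I u = trace_of I v \<longleftrightarrow> trace_equiv I u v"
  unfolding trace_of_def
  using eq_equiv_class_iff[OF equiv_trace_rel, of u v I] by (simp add: trace_rel_def)

lemma carrier_trace_monoid: "carrier (trace_monoid I) = range (trace_of I)"
  by (auto simp: trace_monoid_def trace_of_def quotient_def)

lemma mult_trace_of:
  "trace_of I u \<otimes>\<^bsub>trace_monoid I\<^esub> trace_of I v = trace_of I (u @ v)"
proof -
  have eq: "trace_of I (u' @ v') = trace_of I (u @ v)"
    if "u' \<in> trace_of I u" "v' \<in> trace_of I v" for u' v'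
    using that trace_equiv.sym[OF trace_equiv.append[of I u u' v v']] unfolding trace_of_eq_iff
    by (simp add: trace_of_def trace_rel_def)
  have self: "w \<in> trace_of I w" for w
    by (simp add: trace_of_def trace_rel_def trace_equiv.refl)
  have "trace_of I u \<otimes>\<^bsub>trace_monoid I\<^esub> trace_of I v
      = (\<Union>u'\<in>trace_of I u. \<Union>v'\<in>trace_of I v. trace_of I (u' @ v'))"
    by (simp add: trace_monoid_def)
  also have "\<dots> = (\<Union>u'\<in>trace_of I u. \<Union>v'\<in>trace_of I v. trace_of I (u @ v))"
    by (intro SUP_cong HOL.refl) (rule eq)
  also have "\<dots> = trace_of I (u @ v)"
    using self[of u] self[of v] by blast
  finally show ?thesis .
qed

lemma monoid_trace_monoid: "monoid (trace_monoid I)"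
proof -
  have "\<one>\<^bsub>trace_monoid I\<^esub> = trace_of I []"
    by (simp add: trace_monoid_def)
  then show ?thesis
    by unfold_locales (auto simp: carrier_trace_monoid mult_trace_of)
qed

lemma trace_equiv_move:
  assumes "\<And>b. b \<in> set p \<Longrightarrow> (b, a) \<in> I"
  shows "trace_equiv I (p @ [a]) (a # p)"
  using assms
proof (induction p)
  case Nil
  then show ?case by (simp add: trace_equiv.refl)
next
  case (Cons b p)
  have "trace_equiv I ([b] @ (p @ [a])) ([b] @ (a # p))"
    by (rule trace_equiv.append) (use Cons in \<open>auto intro: trace_equiv.refl\<close>)
  moreover have "trace_equiv I ([b, a] @ p) ([a, b] @ p)"
    by (rule trace_equiv.append) (use Cons in \<open>auto intro: trace_equiv.refl trace_equiv.swap\<close>)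
  ultimately show ?case
    using trace_equiv.trans[of I "b # p @ [a]" "b # a # p" "a # b # p"] by simp
qed

lemma trace_equiv_clique:
  assumes "distinct w" "distinct w'" "set w = set w'" "set w \<in> cliques I"
  shows "trace_equiv I w w'"
  using assms
proof (induction w arbitrary: w')
  case Nil
  then show ?case by (simp add: trace_equiv.refl)
next
  case (Cons a w)
  obtain p q where w': "w' = p @ a # q"
    using Cons.prems(3) by (metis list.set_intros(1) split_list)
  have "trace_equiv I (p @ [a]) (a # p)"
    by (rule trace_equiv_move) (use Cons.prems w' in \<open>auto simp: cliques_def\<close>)
  then have "trace_equiv I ((p @ [a]) @ q) ((a # p) @ q)"
    by (rule trace_equiv.append) (rule trace_equiv.refl)
  moreover have "trace_equiv I w (p @ q)"
  proof (rule Cons.IH)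
    show "set w = set (p @ q)"
      using Cons.prems(1-3) w' by auto
    show "set w \<in> cliques I"
      using Cons.prems(4) by (simp add: cliques_def)
  qed (use Cons.prems(1,2) w' in simp_all)
  then have "trace_equiv I ([a] @ w) ([a] @ (p @ q))"
    by (rule trace_equiv.append[OF trace_equiv.refl])
  ultimately show ?case
    using trace_equiv.trans[of I "a # w" "a # p @ q" w'] trace_equiv.sym[of I w' "a # p @ q"]
    by (simp add: w')
qed

lemma clique_trace_eq:
  assumes "set w \<in> cliques I" "distinct w"
  shows "clique_trace I (set w) = trace_of I w"
  unfolding clique_trace_def
proof (rule the_equality)
  fix t
  assume "\<exists>w'. distinct w' \<and> set w' = set w \<and> t = trace_of I w'"
  then obtain w' where w': "distinct w'" "set w' = set w" "t = trace_of I w'"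
    by blast
  show "t = trace_of I w"
    unfolding w'(3) trace_of_eq_iff by (rule trace_equiv_clique) (use assms w' in simp_all)
qed (use assms in blast)

lemma equiv_Linf_rel: "equiv (ess_bounded M) (Linf_rel M)"
proof (rule equivI)
  show "trans (Linf_rel M)"
  proof (rule transI)
    fix f g h
    assume "(f, g) \<in> Linf_rel M" "(g, h) \<in> Linf_rel M"
    then show "(f, h) \<in> Linf_rel M"
      unfolding Linf_rel_def by (auto elim: eventually_elim2)
  qed
  show "sym (Linf_rel M)"
  proof (rule symI)
    fix f g
    assume "(f, g) \<in> Linf_rel M"
    then show "(g, f) \<in> Linf_rel M"
      unfolding Linf_rel_def by (auto elim: eventually_mono)
  qed
qed (auto simp: Linf_rel_def refl_on_def)

lemma Linf_norm_class:
  assumes "f \<in> ess_bounded M"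
  shows "Linf_norm M (Linf_rel M `` {f}) = real_of_ereal (esssup M (\<lambda>x. ereal \<bar>f x\<bar>))"
proof -
  have eq: "esssup M (\<lambda>x. ereal \<bar>g x\<bar>) = esssup M (\<lambda>x. ereal \<bar>f x\<bar>)"
    if "(f, g) \<in> Linf_rel M" for g
  proof -
    have [measurable]: "f \<in> borel_measurable M" "g \<in> borel_measurable M"
      and "AE x in M. f x = g x"
      using that by (auto simp: Linf_rel_def ess_bounded_def)
    then have "AE x in M. ereal \<bar>g x\<bar> = ereal \<bar>f x\<bar>"
      by (auto elim: eventually_mono)
    then show ?thesis
      by (rule esssup_AE_cong[rotated 2]) measurable
  qed
  have self: "f \<in> Linf_rel M `` {f}"
    using assms by (simp add: Linf_rel_def)
  have "(\<lambda>g. real_of_ereal (esssup M (\<lambda>x. ereal \<bar>g x\<bar>))) ` (Linf_rel M `` {f})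
      = {real_of_ereal (esssup M (\<lambda>x. ereal \<bar>f x\<bar>))}"
  proof (rule equalityI[OF image_subsetI])
    fix g
    assume "g \<in> Linf_rel M `` {f}"
    then show "real_of_ereal (esssup M (\<lambda>x. ereal \<bar>g x\<bar>)) \<in> {real_of_ereal (esssup M (\<lambda>x. ereal \<bar>f x\<bar>))}"
      using eq[of g] by simp
  qed (use self in blast)
  then show ?thesis
    by (simp add: Linf_norm_def)
qed

lemma Linf_integral_class:
  assumes "f \<in> ess_bounded M" "A \<in> sets M"
  shows "Linf_integral M A (Linf_rel M `` {f}) = (LINT x:A|M. f x)"
proof -
  have eq: "(LINT x:A|M. g x) = (LINT x:A|M. f x)" if "(f, g) \<in> Linf_rel M" for g
  proof -
    have [measurable]: "f \<in> borel_measurable M" "g \<in> borel_measurable M" "A \<in> sets M"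
      and "AE x in M. f x = g x"
      using that assms by (auto simp: Linf_rel_def ess_bounded_def)
    then have "AE x in M. indicator A x *\<^sub>R g x = indicator A x *\<^sub>R f x"
      by (auto elim: eventually_mono)
    then show ?thesis
      unfolding set_lebesgue_integral_def by (rule integral_cong_AE[rotated 2]) measurable
  qed
  have self: "f \<in> Linf_rel M `` {f}"
    using assms by (simp add: Linf_rel_def)
  have "(\<lambda>g. LINT x:A|M. g x) ` (Linf_rel M `` {f}) = {LINT x:A|M. f x}"
  proof (rule equalityI[OF image_subsetI])
    fix g
    assume "g \<in> Linf_rel M `` {f}"
    then show "(LINT x:A|M. g x) \<in> {(LINT x:A|M. f x)}"
      using eq[of g] by simp
  qed (use self in blast)
  then show ?thesis
    by (simp add: Linf_integral_def)
qed

lemma trace_le_refl: "u \<in> carrier (trace_monoid I) \<Longrightarrow> trace_le I u u"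
  unfolding trace_le_def
  using monoid.one_closed[OF monoid_trace_monoid] monoid.r_one[OF monoid_trace_monoid]
  by metis

lemma trace_le_trans:
  assumes "u \<in> carrier (trace_monoid I)" "trace_le I u v" "trace_le I v w"
  shows "trace_le I u w"
  using assms unfolding trace_le_def
  by (metis monoid.m_assoc[OF monoid_trace_monoid] monoid.m_closed[OF monoid_trace_monoid])

lemma equiv_chain_rel: "equiv (trace_chains I) (chain_rel I)"
proof (rule equivI)
  have le_trans: "chain_le I x z"
    if "x \<in> trace_chains I" "chain_le I x y" "chain_le I y z" for x y z
    using that unfolding chain_le_def trace_chains_def mem_Collect_eq
    by (meson trace_le_trans)
  show "trans (chain_rel I)"
    unfolding trans_def chain_rel_def by (auto intro: le_trans)
  show "refl_on (trace_chains I) (chain_rel I)"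
    unfolding refl_on_def chain_rel_def chain_le_def trace_chains_def
    by (auto intro: trace_le_refl)
qed (auto simp: chain_rel_def sym_def)

end

theory Submission
  imports Defs
begin

text \<open>
  Write \<open>f u\<close> for the measure of the cylinder of \<open>u\<close>, fix a letter \<open>a\<close>, and let \<open>V n \<xi>\<close> be the
  shortest prefix of the infinite trace \<open>\<xi>\<close> containing \<open>n\<close> occurrences of \<open>a\<close>. The possible values
  of \<open>V n\<close> are pyramids with apex \<open>a\<close>, and their cylinders are pairwise disjoint. By irreducibility,
  \<open>f\<close> is summable over the traces that avoid \<open>a\<close>; summing the harmonicity equations of \<open>h\<close> over
  these traces and applying Moebius inversion gives the stopping identity: \<open>h u\<close> is the sum of
  \<open>f v * h (u v)\<close> over the pyramids \<open>v\<close> with one occurrence of \<open>a\<close>. In particular the cylinders of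
  the values of \<open>V n\<close> partition the boundary up to a null set, and \<open>h (V n \<xi>)\<close> is a bounded
  martingale. Its limit is a density that represents \<open>h\<close> on pyramids. It represents \<open>h\<close> everywhere,
  because every trace becomes a pyramid after multiplication by a pyramid containing all letters.
  For \<open>0 \<le> h \<le> K\<close> the density lies between \<open>0\<close> and \<open>K\<close>, which yields positivity of the inverse
  and, after shifting \<open>h\<close> by a constant, the isometry. Uniqueness holds because cylinders are closed
  under nonempty intersections (traces with a common upper bound have a least one).
\<close>

section \<open>Combinatorics of traces\<close>

text \<open>A single harmonicity equation is an alternating sum over overlapping cylinders, hence
  not a mean value property; waiting for the next \<open>a\<close> turns it into one over disjoint
  cylinders. The mechanism is a split of the cliques by whether they contain \<open>a\<close>.
  Deleting \<open>a\<close> from a clique flips the sign, so each equation balances cliques avoiding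
  \<open>a\<close> against cliques commuting with \<open>a\<close>. Summed over the traces avoiding
  \<open>a\<close>, inversion leaves only the empty trace on the first side and exactly the traces
  that \<open>a\<close> completes to a pyramid on the second. The summability behind this
  rearrangement is an induction on the set of allowed letters, which dependence makes shrink. The
  passage from pyramids to all traces is a contraction: the defect between the integral and its
  predicted value is additive over the pyramids following a trace, at most a multiple of the weight,
  and zero after a pyramid \<open>p\<close> with all letters. By multiplicativity of the measure,
  \<open>p\<close> removes the same proportion \<open>weight p\<close> of the bound at every trace,
  so the step can be iterated.\<close>

locale independence =
  fixes I :: "('a::finite \<times> 'a) set"
  assumes sym_I: "sym I" and irrefl_I: "irrefl I"
begin

abbreviation tr :: "'a list \<Rightarrow> 'a list set" where "tr \<equiv> trace_of I"
abbreviation traces :: "'a list set set" where "traces \<equiv> carrier (trace_monoid I)"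
abbreviation tmult :: "'a list set \<Rightarrow> 'a list set \<Rightarrow> 'a list set" (infixl "\<odot>" 70)
  where "u \<odot> v \<equiv> u \<otimes>\<^bsub>trace_monoid I\<^esub> v"
abbreviation tle :: "'a list set \<Rightarrow> 'a list set \<Rightarrow> bool" (infix "\<preceq>" 50)
  where "u \<preceq> v \<equiv> trace_le I u v"
abbreviation letter :: "'a \<Rightarrow> 'a list set" where "letter a \<equiv> tr [a]"
abbreviation indep :: "'a \<Rightarrow> 'a set" where "indep a \<equiv> {b. (a, b) \<in> I}"

lemma I_commute: "(a, b) \<in> I \<longleftrightarrow> (b, a) \<in> I"
  using sym_I by (auto dest: symD)

lemma not_I_self [simp]: "(a, a) \<notin> I"
  using irrefl_I by (auto simp: irrefl_def)

subsection \<open>Words\<close>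

text \<open>Decides on a word whether commutations can bring \<open>a\<close> to the front. Being
  recursive on words, it reduces divisibility of traces by letters to structural induction.\<close>

primrec min_letter :: "'a \<Rightarrow> 'a list \<Rightarrow> bool" where
  "min_letter a [] \<longleftrightarrow> False"
| "min_letter a (b # w) \<longleftrightarrow> a = b \<or> b \<in> indep a \<and> min_letter a w"

lemma min_letter_append:
  "min_letter a (u @ v) \<longleftrightarrow> min_letter a u \<or> set u \<subseteq> indep a \<and> min_letter a v"
  by (induction u) auto

lemma trace_equiv_set: "trace_equiv I u v \<Longrightarrow> set u = set v"
  by (induction rule: trace_equiv.induct) auto

lemma trace_equiv_length: "trace_equiv I u v \<Longrightarrow> length u = length v"
  by (induction rule: trace_equiv.induct) auto

lemma trace_equiv_count_list: "trace_equiv I u v \<Longrightarrow> count_list u a = count_list v a"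
  by (induction rule: trace_equiv.induct) auto

lemma trace_equiv_min_letter: "trace_equiv I u v \<Longrightarrow> min_letter a u \<longleftrightarrow> min_letter a v"
proof (induction rule: trace_equiv.induct)
  case (swap b c)
  then show ?case using I_commute by auto
next
  case (append u u' v v')
  then show ?case by (simp add: min_letter_append trace_equiv_set)
qed auto

lemma trace_equiv_rev: "trace_equiv I u v \<Longrightarrow> trace_equiv I (rev u) (rev v)"
proof (induction rule: trace_equiv.induct)
  case (swap a b)
  then show ?case using I_commute by (auto intro: trace_equiv.swap)
qed (auto intro: trace_equiv.refl trace_equiv.sym trace_equiv.trans trace_equiv.append)

text \<open>A generating swap stays one, or collapses to an equality, when a letter is removed; in a
  product, the letter set of the left factor decides which factor loses the letter. Cancellation
  rests on this.\<close>

lemma trace_equiv_remove1: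
  "trace_equiv I u v \<Longrightarrow> trace_equiv I (remove1 a u) (remove1 a v)"
proof (induction rule: trace_equiv.induct)
  case (append u u' v v')
  then show ?case
    using trace_equiv_set[OF append.hyps(1)]
    by (auto simp: remove1_append intro: trace_equiv.append)
qed (auto intro: trace_equiv.intros)

lemma min_letter_move:
  "min_letter a w \<Longrightarrow> trace_equiv I w (a # remove1 a w)"
proof (induction w)
  case (Cons b w)
  show ?case
  proof (cases "a = b")
    case False
    then have "(b, a) \<in> I" and "trace_equiv I w (a # remove1 a w)"
      using Cons I_commute by auto
    then have "trace_equiv I ([b] @ w) ([b] @ (a # remove1 a w))"
      and "trace_equiv I ([b, a] @ remove1 a w) ([a, b] @ remove1 a w)"
      by (blast intro: trace_equiv.append trace_equiv.refl trace_equiv.swap)+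
    then show ?thesis
      using False by (auto intro: trace_equiv.trans)
  qed (auto intro: trace_equiv.refl)
qed simp

subsection \<open>Divisibility by letters\<close>

lemma tracesE: assumes "u \<in> traces" obtains w where "u = tr w"
  using assms by (auto simp: carrier_trace_monoid)

lemma tr_in_traces [simp, intro]: "tr w \<in> traces"
  by (simp add: carrier_trace_monoid)

lemma tmult_closed [simp, intro]: "u \<in> traces \<Longrightarrow> v \<in> traces \<Longrightarrow> u \<odot> v \<in> traces"
  by (rule monoid.m_closed[OF monoid_trace_monoid])

lemma tmult_assoc:
  "u \<in> traces \<Longrightarrow> v \<in> traces \<Longrightarrow> w \<in> traces \<Longrightarrow> u \<odot> v \<odot> w = u \<odot> (v \<odot> w)"
  by (rule monoid.m_assoc[OF monoid_trace_monoid])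

lemma tr_Cons: "tr (a # w) = letter a \<odot> tr w"
  by (simp add: mult_trace_of)

lemma tr_Nil_left [simp]: "u \<in> traces \<Longrightarrow> tr [] \<odot> u = u"
  by (elim tracesE) (simp add: mult_trace_of)

lemma tr_Nil_right [simp]: "u \<in> traces \<Longrightarrow> u \<odot> tr [] = u"
  by (elim tracesE) (simp add: mult_trace_of)

lemma letter_left_cancel:
  assumes "letter a \<odot> u = letter a \<odot> v" "u \<in> traces" "v \<in> traces" shows "u = v"
proof -
  obtain x y where xy: "u = tr x" "v = tr y" using assms by (meson tracesE)
  then have "trace_equiv I (a # x) (a # y)"
    using assms(1) by (simp add: mult_trace_of trace_of_eq_iff)
  from trace_equiv_remove1[OF this, of a] show ?thesis
    by (simp add: xy trace_of_eq_iff)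
qed

lemma tmult_left_cancel:
  assumes "x \<odot> u = x \<odot> v" "x \<in> traces" "u \<in> traces" "v \<in> traces" shows "u = v"
proof -
  obtain w where "x = tr w" using assms by (meson tracesE)
  moreover have "tr w \<odot> u = tr w \<odot> v \<Longrightarrow> u = v"
  proof (induction w)
    case (Cons a w)
    have "letter a \<odot> (tr w \<odot> u) = letter a \<odot> (tr w \<odot> v)"
      using Cons.prems assms by (simp add: tr_Cons[of a w] tmult_assoc)
    from letter_left_cancel[OF this] show ?case
      using assms Cons.IH by simp
  qed (use assms in simp)
  ultimately show ?thesis using assms by simp
qed

lemma tmult_right_cancel:
  assumes "u \<odot> x = v \<odot> x" "x \<in> traces" "u \<in> traces" "v \<in> traces" shows "u = v"
proof -
  obtain p q w where w: "u = tr p" "v = tr q" "x = tr w" using assms by (meson tracesE)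
  have rev_iff: "tr (rev p) = tr (rev q) \<longleftrightarrow> tr p = tr q" for p q
    using trace_equiv_rev[of p q] trace_equiv_rev[of "rev p" "rev q"]
    by (auto simp: trace_of_eq_iff)
  have "tr (rev w) \<odot> tr (rev p) = tr (rev w) \<odot> tr (rev q)"
    using assms(1) rev_iff[of "p @ w" "q @ w"] by (simp add: w mult_trace_of)
  from tmult_left_cancel[OF this] show ?thesis by (simp add: w rev_iff)
qed

lemma letter_tle_iff: "letter a \<preceq> tr w \<longleftrightarrow> min_letter a w"
proof
  assume "letter a \<preceq> tr w"
  then obtain v where "trace_equiv I w (a # v)"
    by (auto simp: trace_le_def carrier_trace_monoid mult_trace_of trace_of_eq_iff)
  from trace_equiv_min_letter[OF this, of a] show "min_letter a w" by simp
next
  assume "min_letter a w"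
  then have "tr w = letter a \<odot> tr (remove1 a w)"
    by (simp add: mult_trace_of trace_of_eq_iff min_letter_move)
  then show "letter a \<preceq> tr w" unfolding trace_le_def by blast
qed

definition letters :: "'a list set \<Rightarrow> 'a set" where
  "letters t = (\<Union>w\<in>t. set w)"

definition tlen :: "'a list set \<Rightarrow> nat" where
  "tlen t = length (SOME w. w \<in> t)"

definition tcount :: "'a \<Rightarrow> 'a list set \<Rightarrow> nat" where
  "tcount a t = count_list (SOME w. w \<in> t) a"

text \<open>The maximal pieces when a trace is viewed as a heap.\<close>

definition maxs :: "'a list set \<Rightarrow> 'a set" where
  "maxs t = {a. \<exists>u\<in>traces. t = u \<odot> letter a}"

lemma in_tr_iff: "v \<in> tr w \<longleftrightarrow> trace_equiv I w v"
  by (simp add: trace_of_def trace_rel_def)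

lemma some_in_tr: "trace_equiv I w (SOME v. v \<in> tr w)"
  by (rule someI2[of _ w]) (auto simp: in_tr_iff trace_equiv.refl)

lemma letters_tr [simp]: "letters (tr w) = set w"
  using trace_equiv_set[of w] trace_equiv.refl[of I w] unfolding letters_def in_tr_iff[symmetric]
  by blast

lemma tlen_tr [simp]: "tlen (tr w) = length w"
  using trace_equiv_length[OF some_in_tr[of w]] by (simp add: tlen_def)

lemma tcount_tr [simp]: "tcount a (tr w) = count_list w a"
  using trace_equiv_count_list[OF some_in_tr[of w]] by (simp add: tcount_def)

lemma letters_tmult [simp]:
  "u \<in> traces \<Longrightarrow> v \<in> traces \<Longrightarrow> letters (u \<odot> v) = letters u \<union> letters v"
  by (elim tracesE) (simp add: mult_trace_of)

lemma tlen_tmult [simp]: "u \<in> traces \<Longrightarrow> v \<in> traces \<Longrightarrow> tlen (u \<odot> v) = tlen u + tlen v"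
  by (elim tracesE) (simp add: mult_trace_of)

lemma tcount_tmult [simp]:
  "u \<in> traces \<Longrightarrow> v \<in> traces \<Longrightarrow> tcount a (u \<odot> v) = tcount a u + tcount a v"
  by (elim tracesE) (simp add: mult_trace_of)

lemma tcount_eq_0_iff: "u \<in> traces \<Longrightarrow> tcount a u = 0 \<longleftrightarrow> a \<notin> letters u"
  by (elim tracesE) (simp add: count_list_0_iff)

lemma maxs_tr: "maxs (tr w) = {a. min_letter a (rev w)}"
proof (intro equalityI subsetI CollectI; (elim CollectE)?)
  fix a assume "a \<in> maxs (tr w)"
  then obtain v where "trace_equiv I w (v @ [a])"
    by (auto simp: maxs_def carrier_trace_monoid mult_trace_of trace_of_eq_iff)
  from trace_equiv_min_letter[OF trace_equiv_rev[OF this], of a]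
  show "min_letter a (rev w)" by simp
next
  fix a assume "min_letter a (rev w)"
  from trace_equiv_rev[OF min_letter_move[OF this]]
  have "tr w = tr (rev (remove1 a (rev w))) \<odot> letter a"
    by (simp add: mult_trace_of trace_of_eq_iff)
  then show "a \<in> maxs (tr w)" unfolding maxs_def by blast
qed

lemma maxs_tmult:
  assumes "u \<in> traces" "v \<in> traces"
  shows "maxs (u \<odot> v) = maxs v \<union> {a \<in> maxs u. letters v \<subseteq> indep a}"
  using assms by (elim tracesE) (auto simp: mult_trace_of maxs_tr min_letter_append)

lemma maxs_letter [simp]: "maxs (letter a) = {a}"
  by (auto simp: maxs_tr)

lemma maxs_Nil [simp]: "maxs (tr []) = {}"
  by (auto simp: maxs_tr)

lemma maxs_subset_letters: "u \<in> traces \<Longrightarrow> maxs u \<subseteq> letters u"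
  by (auto simp: maxs_def)

lemma maxsE:
  assumes "a \<in> maxs u" obtains v where "v \<in> traces" "u = v \<odot> letter a"
  using assms by (auto simp: maxs_def)

lemma maxs_eq_empty_iff: "u \<in> traces \<Longrightarrow> maxs u = {} \<longleftrightarrow> u = tr []"
proof (elim tracesE)
  fix w assume "u = tr w"
  then show "maxs u = {} \<longleftrightarrow> u = tr []"
    by (cases w rule: rev_cases) (auto simp: maxs_tr trace_of_eq_iff dest: trace_equiv_length)
qed

lemma letter_tle_tmult_iff:
  "u \<in> traces \<Longrightarrow> v \<in> traces \<Longrightarrow>
    letter a \<preceq> u \<odot> v \<longleftrightarrow> letter a \<preceq> u \<or> letters u \<subseteq> indep a \<and> letter a \<preceq> v"
  by (elim tracesE) (simp add: mult_trace_of letter_tle_iff min_letter_append)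

lemma letter_tle_letters: "letter a \<preceq> u \<Longrightarrow> a \<in> letters u"
  by (auto simp: trace_le_def)

lemma letter_commute:
  assumes "u \<in> traces" "letters u \<subseteq> indep a" shows "u \<odot> letter a = letter a \<odot> u"
proof -
  obtain w where w: "u = tr w" using assms tracesE by blast
  have "trace_equiv I (w @ [a]) (a # w)"
    by (rule trace_equiv_move) (use assms I_commute in \<open>auto simp: w\<close>)
  then show ?thesis by (simp add: w mult_trace_of trace_of_eq_iff)
qed

lemma tleI [intro]: "w \<in> traces \<Longrightarrow> u \<preceq> u \<odot> w"
  by (auto simp: trace_le_def)

lemma tleE:
  assumes "u \<preceq> v" obtains w where "w \<in> traces" "v = u \<odot> w"
  using assms by (auto simp: trace_le_def)

lemma tle_tmult_left_iff:
  assumes "x \<in> traces" "u \<in> traces" "v \<in> traces"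
  shows "x \<odot> u \<preceq> x \<odot> v \<longleftrightarrow> u \<preceq> v"
proof
  assume "x \<odot> u \<preceq> x \<odot> v"
  then obtain w where w: "w \<in> traces" "x \<odot> v = x \<odot> (u \<odot> w)"
    using assms by (auto elim!: tleE simp: tmult_assoc)
  then have "v = u \<odot> w" using tmult_left_cancel[of x v "u \<odot> w"] assms by simp
  then show "u \<preceq> v" using w by auto
next
  assume "u \<preceq> v"
  then show "x \<odot> u \<preceq> x \<odot> v"
    using assms by (auto elim!: tleE simp: tmult_assoc[symmetric])
qed

lemma trace_cases:
  assumes "u \<in> traces"
  obtains "u = tr []" | b v where "v \<in> traces" "u = letter b \<odot> v"
proof -
  obtain w where "u = tr w" using assms tracesE by blast
  then show thesis using that(1) that(2)[OF tr_in_traces HOL.trans[OF _ tr_Cons]] by (cases w) blast+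
qed

text \<open>An \<open>a\<close> that divides \<open>x\<close> but not its prefix \<open>v\<close>
  has to come from the rest of \<open>x\<close>, so it commutes with all of \<open>v\<close> and can
  be placed on either side of it.\<close>

lemma letter_tle_split:
  assumes "letter a \<preceq> x" "v \<preceq> x" "v \<in> traces" "\<not> letter a \<preceq> v"
  shows "letters v \<subseteq> indep a" "letter a \<odot> v \<preceq> x" "v \<odot> letter a \<preceq> x"
proof -
  obtain y where y: "y \<in> traces" "x = v \<odot> y" using assms(2) by (rule tleE)
  then have v: "letters v \<subseteq> indep a" and "letter a \<preceq> y"
    using assms letter_tle_tmult_iff[of v y a] by auto
  then obtain z where z: "z \<in> traces" "y = letter a \<odot> z" by (auto elim: tleE)
  show "letters v \<subseteq> indep a" by fact
  have "x = v \<odot> letter a \<odot> z" using y z assms by (simp add: tmult_assoc)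
  then show "v \<odot> letter a \<preceq> x" "letter a \<odot> v \<preceq> x"
    using z letter_commute[OF assms(3) v] by auto
qed

text \<open>Induction on the length of \<open>u\<close>, stripping its first letter \<open>b\<close>
  from \<open>u\<close> and, if possible, from \<open>v\<close>. If \<open>b\<close> does not divide
  \<open>v\<close>, the common upper bound forces \<open>v\<close> to commute with \<open>b\<close>,
  and \<open>v\<close> can stay as it is. In both cases left multiplication by \<open>b\<close>
  matches the upper bounds of the residues with those of \<open>u\<close> and \<open>v\<close>, so
  the least one lifts.\<close>

lemma trace_lub:
  assumes "u \<in> traces" "v \<in> traces" "u \<preceq> x" "v \<preceq> x" "x \<in> traces"
  shows "\<exists>w\<in>traces. u \<preceq> w \<and> v \<preceq> w \<and> (\<forall>y\<in>traces. u \<preceq> y \<longrightarrow> v \<preceq> y \<longrightarrow> w \<preceq> y)"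
  using assms
proof (induction "tlen u" arbitrary: u v x)
  case 0
  then obtain p where "u = tr p" "length p = 0" by (metis tlen_tr tracesE)
  then have "u = tr []" by simp
  then show ?case
    using 0 trace_le_refl[of v I] by (intro bexI[of _ v]) (auto simp: trace_le_def)
next
  case (Suc n)
  from \<open>u \<in> traces\<close> show ?case
  proof (cases rule: trace_cases)
    case 1
    then show ?thesis using Suc by simp
  next
    case (2 b u')
    have n: "n = tlen u'" using Suc.hyps(2) 2 by simp
    have bu: "letter b \<preceq> y" if "u \<preceq> y" for y
      using that 2 trace_le_trans[of "letter b" I u y] by auto
    define v' where "v' = (if letter b \<preceq> v then (SOME z. z \<in> traces \<and> v = letter b \<odot> z) else v)"
    have v': "v' \<in> traces \<and> (if letter b \<preceq> v then v = letter b \<odot> v' else v = v')"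
      unfolding v'_def using someI_ex[of "\<lambda>z. z \<in> traces \<and> v = letter b \<odot> z"] Suc.prems
      by (auto elim!: tleE)
    have le_iff: "u' \<preceq> y \<and> v' \<preceq> y \<longleftrightarrow> u \<preceq> letter b \<odot> y \<and> v \<preceq> letter b \<odot> y"
      if "y \<in> traces" for y
    proof (cases "letter b \<preceq> v")
      case True
      then show ?thesis using 2 v' that by (simp add: tle_tmult_left_iff)
    next
      case False
      then have "v = v'" using v' by simp
      have "v \<preceq> y \<longleftrightarrow> v \<preceq> letter b \<odot> y" if "letters v \<subseteq> indep b"
      proof -
        have "v \<preceq> letter b \<odot> y \<longleftrightarrow> letter b \<odot> v \<preceq> letter b \<odot> y"
        proof
          assume "v \<preceq> letter b \<odot> y"
          then show "letter b \<odot> v \<preceq> letter b \<odot> y"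
            using letter_tle_split(2)[of b "letter b \<odot> y" v] False \<open>y \<in> traces\<close> Suc.prems by auto
        next
          assume "letter b \<odot> v \<preceq> letter b \<odot> y"
          then have "v \<odot> letter b \<preceq> letter b \<odot> y"
            using letter_commute[OF _ that] Suc.prems by simp
          then show "v \<preceq> letter b \<odot> y"
            using trace_le_trans[of v I "v \<odot> letter b"] Suc.prems by auto
        qed
        then show ?thesis
          using tle_tmult_left_iff \<open>y \<in> traces\<close> Suc.prems by simp
      qed
      moreover have "letters v \<subseteq> indep b"
        using letter_tle_split(1)[of b x v] False bu Suc.prems by auto
      ultimately show ?thesis
        using 2 \<open>v = v'\<close> that by (simp add: tle_tmult_left_iff)
    qed
    obtain x' where x': "x' \<in> traces" "x = letter b \<odot> x'"
      using bu[OF Suc.prems(3)] by (rule tleE)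
    then have "u' \<preceq> x'" "v' \<preceq> x'" using le_iff[of x'] Suc.prems by auto
    from Suc.hyps(1)[OF n _ _ this] obtain w
      where w: "w \<in> traces" "u' \<preceq> w" "v' \<preceq> w" "\<And>y. y \<in> traces \<Longrightarrow> u' \<preceq> y \<Longrightarrow> v' \<preceq> y \<Longrightarrow> w \<preceq> y"
      using 2 v' x' by blast
    have "letter b \<odot> w \<preceq> y" if y: "y \<in> traces" "u \<preceq> y" "v \<preceq> y" for y
    proof -
      obtain y' where "y' \<in> traces" "y = letter b \<odot> y'"
        using bu[OF y(2)] by (rule tleE)
      then show ?thesis
        using w le_iff[of y'] y by (auto simp: tle_tmult_left_iff)
    qed
    then show ?thesis
      using w le_iff[of w] by (intro bexI[of _ "letter b \<odot> w"]) auto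
  qed
qed

subsection \<open>Cliques\<close>

lemma clique_trace_in_traces [simp, intro]:
  assumes "c \<in> cliques I" shows "clique_trace I c \<in> traces"
proof -
  obtain w where "set w = c" "distinct w" using finite_distinct_list[of c] by auto
  then show ?thesis using clique_trace_eq[of w I] assms by auto
qed

lemma letters_clique_trace [simp]:
  assumes "c \<in> cliques I" shows "letters (clique_trace I c) = c"
proof -
  obtain w where "set w = c" "distinct w" using finite_distinct_list[of c] by auto
  then show ?thesis using clique_trace_eq[of w I] assms by auto
qed

lemma clique_trace_empty [simp]: "clique_trace I {} = tr []"
  using clique_trace_eq[of "[]" I] by (simp add: cliques_def)

lemma empty_in_cliques [simp]: "{} \<in> cliques I"
  by (simp add: cliques_def)

lemma insert_in_cliques_iff:
  "a \<notin> c \<Longrightarrow> insert a c \<in> cliques I \<longleftrightarrow> c \<in> cliques I \<and> c \<subseteq> indep a"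
  unfolding cliques_def using I_commute by auto

lemma clique_trace_insert:
  assumes "insert a c \<in> cliques I" "a \<notin> c"
  shows "clique_trace I (insert a c) = clique_trace I c \<odot> letter a"
    "clique_trace I (insert a c) = letter a \<odot> clique_trace I c"
proof -
  have c: "c \<in> cliques I" "c \<subseteq> indep a" using assms insert_in_cliques_iff by auto
  obtain w where w: "set w = c" "distinct w" using finite_distinct_list[of c] by auto
  then have "clique_trace I (insert a c) = letter a \<odot> tr w" "clique_trace I c = tr w"
    using clique_trace_eq[of w I] clique_trace_eq[of "a # w" I] assms c
    by (auto simp: mult_trace_of)
  then show "clique_trace I (insert a c) = letter a \<odot> clique_trace I c"
    "clique_trace I (insert a c) = clique_trace I c \<odot> letter a"
    using letter_commute[of "tr w" a] c w by auto
qed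

lemma subset_clique: "c \<in> cliques I \<Longrightarrow> d \<subseteq> c \<Longrightarrow> d \<in> cliques I"
  by (auto simp: cliques_def)

lemma maxs_in_cliques: assumes "u \<in> traces" shows "maxs u \<in> cliques I"
proof -
  have "(a, b) \<in> I" if ab: "a \<in> maxs u" "b \<in> maxs u" "a \<noteq> b" for a b
  proof -
    obtain v where v: "v \<in> traces" "u = v \<odot> letter a" using ab maxsE by blast
    then show ?thesis using ab I_commute by (auto simp: maxs_tmult)
  qed
  then show ?thesis by (simp add: cliques_def)
qed

text \<open>Maximal letters commute pairwise and can be peeled off together. As a subset condition,
  right divisibility by cliques leads to alternating sums over power sets in the Moebius
  inversion.\<close>

lemma clique_subset_maxs_iff:
  assumes "c \<in> cliques I" "x \<in> traces"
  shows "c \<subseteq> maxs x \<longleftrightarrow> (\<exists>w\<in>traces. x = w \<odot> clique_trace I c)"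
  using finite[of c] assms
proof (induction c arbitrary: x rule: finite_induct)
  case empty
  then show ?case by (auto intro: bexI[of _ x])
next
  case (insert a c)
  have c: "c \<in> cliques I" "c \<subseteq> indep a" using insert insert_in_cliques_iff by auto
  show ?case
  proof
    assume sub: "insert a c \<subseteq> maxs x"
    then obtain v where v: "v \<in> traces" "x = v \<odot> letter a" by (auto elim: maxsE)
    then have "c \<subseteq> maxs v" using sub insert(2) by (auto simp: maxs_tmult)
    then obtain w where "w \<in> traces" "v = w \<odot> clique_trace I c"
      using insert.IH v c by blast
    then show "\<exists>w\<in>traces. x = w \<odot> clique_trace I (insert a c)"
      using v c insert clique_trace_insert(1)[of a c] by (auto simp: tmult_assoc)
  next
    assume "\<exists>w\<in>traces. x = w \<odot> clique_trace I (insert a c)"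
    then obtain w where w: "w \<in> traces" "x = w \<odot> clique_trace I c \<odot> letter a"
      using c insert clique_trace_insert(1)[of a c] by (auto simp: tmult_assoc)
    then have "c \<subseteq> maxs (w \<odot> clique_trace I c)" using insert.IH c by blast
    then show "insert a c \<subseteq> maxs x" using w c I_commute by (auto simp: maxs_tmult)
  qed
qed

text \<open>Letters dividing the same trace from the left commute pairwise, so they divide it
  jointly. This later identifies the intersections of letter cylinders.\<close>

lemma letters_tle_clique_iff:
  assumes "x \<in> traces"
  shows "(\<forall>a\<in>c. letter a \<preceq> x) \<longleftrightarrow> c \<in> cliques I \<and> clique_trace I c \<preceq> x"
  using finite[of c]
proof (induction c rule: finite_induct)
  case empty
  then show ?case using assms by (auto simp: trace_le_def)
next
  case (insert a c)
  show ?case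
  proof
    assume "\<forall>b\<in>insert a c. letter b \<preceq> x"
    then have c: "c \<in> cliques I" "clique_trace I c \<preceq> x" "letter a \<preceq> x"
      using insert.IH by auto
    have "\<not> letter a \<preceq> clique_trace I c"
      using letter_tle_letters[of a "clique_trace I c"] c insert by auto
    then show "insert a c \<in> cliques I \<and> clique_trace I (insert a c) \<preceq> x"
      using letter_tle_split[of a x "clique_trace I c"] c insert insert_in_cliques_iff[of a c]
        clique_trace_insert(1)[of a c] by auto
  next
    assume *: "insert a c \<in> cliques I \<and> clique_trace I (insert a c) \<preceq> x"
    then have c: "c \<in> cliques I" using insert insert_in_cliques_iff by blast
    have "clique_trace I c \<preceq> x"
      using * insert c clique_trace_insert(1)[of a c]
        trace_le_trans[of "clique_trace I c" I "clique_trace I c \<odot> letter a" x] by auto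
    moreover have "letter a \<preceq> x"
      using * insert c clique_trace_insert(2)[of a c]
        trace_le_trans[of "letter a" I "letter a \<odot> clique_trace I c" x] by auto
    ultimately show "\<forall>b\<in>insert a c. letter b \<preceq> x" using insert.IH c by auto
  qed
qed

subsection \<open>Pyramids\<close>

text \<open>These are the shortest prefixes of infinite traces containing \<open>n\<close> occurrences of \<open>a\<close>.\<close>

definition pyramids :: "'a \<Rightarrow> nat \<Rightarrow> 'a list set set" where
  "pyramids a n = {x \<in> traces. maxs x \<subseteq> {a} \<and> tcount a x = n}"

lemma pyramids_traces: "x \<in> pyramids a n \<Longrightarrow> x \<in> traces"
  by (simp add: pyramids_def)

lemma pyramids_0: "pyramids a 0 = {tr []}"
proof -
  have "x = tr []" if "x \<in> traces" "maxs x \<subseteq> {a}" "tcount a x = 0" for x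
  proof -
    have "maxs x = {}" using that maxs_subset_letters[of x] by (auto simp: tcount_eq_0_iff)
    then show ?thesis using that maxs_eq_empty_iff by blast
  qed
  then show ?thesis by (auto simp: pyramids_def)
qed

text \<open>Induction on length through the first letter \<open>b\<close> of \<open>u\<close>. If
  \<open>b\<close> divides \<open>v\<close>, cancel it. Otherwise all letters of \<open>v\<close>
  are independent of \<open>b\<close>, so \<open>b\<close> differs from \<open>a\<close>; the
  induction hypothesis gives \<open>u' = v\<close>, and \<open>b\<close> commutes to the end of
  \<open>u\<close>, where a pyramid admits only \<open>a\<close>.\<close>

lemma pyramids_common_upper_bound:
  assumes "u \<in> pyramids a n" "v \<in> pyramids a n" "u \<preceq> x" "v \<preceq> x"
  shows "u = v"
  using assms
proof (induction "tlen u" arbitrary: u v x n)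
  case 0
  then have "u = tr []" by (metis length_0_conv pyramids_traces tlen_tr tracesE)
  then show ?case using 0 pyramids_0[of a] by (auto simp: pyramids_def)
next
  case (Suc k)
  have uv: "u \<in> traces" "v \<in> traces" using Suc pyramids_traces by auto
  from uv(1) show ?case
  proof (cases rule: trace_cases)
    case 1
    then show ?thesis using Suc by simp
  next
    case (2 b u')
    have u': "u' \<in> pyramids a (tcount a u')" "k = tlen u'"
      using Suc 2 by (auto simp: pyramids_def maxs_tmult)
    obtain y where y: "y \<in> traces" "x = letter b \<odot> (u' \<odot> y)"
      using Suc.prems(3) 2 by (auto elim!: tleE simp: tmult_assoc)
    then have bx: "letter b \<preceq> x" using 2 by auto
    show ?thesis
    proof (cases "letter b \<preceq> v")
      case True
      then obtain v' where v': "v' \<in> traces" "v = letter b \<odot> v'" by (auto elim: tleE)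
      have "v' \<in> pyramids a (tcount a u')"
        using Suc.prems 2 v' by (auto simp: pyramids_def maxs_tmult)
      moreover have "u' \<preceq> u' \<odot> y" "v' \<preceq> u' \<odot> y"
        using Suc.prems y v' 2 by (auto simp: tle_tmult_left_iff)
      ultimately show ?thesis using Suc.hyps(1)[of u' "tcount a u'" v' "u' \<odot> y"] u' 2 v' by auto
    next
      case False
      note split = letter_tle_split[OF bx Suc.prems(4) uv(2) False]
      have "b \<noteq> a"
      proof
        assume "b = a"
        then have "tcount a v = 0" using split(1) tcount_eq_0_iff uv by auto
        then show False using Suc.prems 2 \<open>b = a\<close> by (auto simp: pyramids_def)
      qed
      then have "v \<in> pyramids a (tcount a u')"
        using Suc.prems 2 by (auto simp: pyramids_def)
      moreover have "v \<preceq> u' \<odot> y"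
        using split(2) y uv 2 by (simp add: tle_tmult_left_iff)
      ultimately have "u' = v" using Suc.hyps(1)[of u' "tcount a u'" v "u' \<odot> y"] u' 2 y by auto
      then have "u = u' \<odot> letter b" using 2 letter_commute split(1) by simp
      then have "b \<in> maxs u" using 2 by (auto simp: maxs_def)
      then show ?thesis using Suc.prems \<open>b \<noteq> a\<close> by (auto simp: pyramids_def)
    qed
  qed
qed

text \<open>Keep moving maximal letters in \<open>Y\<close> from the end of the left factor to the
  front of the right one until none is left.\<close>

lemma strip_maximal:
  assumes "x \<in> traces"
  obtains v w where "v \<in> traces" "w \<in> traces" "x = v \<odot> w" "maxs v \<inter> Y = {}" "letters w \<subseteq> Y"
proof -
  have "\<exists>v\<in>traces. \<exists>w\<in>traces. x = v \<odot> w \<and> maxs v \<inter> Y = {} \<and> letters w \<subseteq> Y"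
    using assms
  proof (induction "tlen x" arbitrary: x rule: less_induct)
    case less
    show ?case
    proof (cases "maxs x \<inter> Y = {}")
      case True
      then show ?thesis using less.prems by (intro bexI[of _ x] bexI[of _ "tr []"]) auto
    next
      case False
      then obtain b where "b \<in> Y" "b \<in> maxs x" by blast
      moreover from this(2) obtain y where "y \<in> traces" "x = y \<odot> letter b" by (rule maxsE)
      ultimately have b: "b \<in> Y" "y \<in> traces" "x = y \<odot> letter b" by auto
      then obtain v w where "v \<in> traces" "w \<in> traces" "y = v \<odot> w" "maxs v \<inter> Y = {}" "letters w \<subseteq> Y"
        using less.hyps[of y] by auto
      then show ?thesis
        using b by (intro bexI[of _ v] bexI[of _ "w \<odot> letter b"]) (auto simp: tmult_assoc)
    qed
  qed
  then show thesis using that by blast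
qed

lemma pyramids_tmult:
  assumes "u \<in> pyramids a m" "v \<in> pyramids a n" "n > 0"
  shows "u \<odot> v \<in> pyramids a (m + n)"
proof -
  have "a \<in> letters v" using assms tcount_eq_0_iff[of v a] by (auto simp: pyramids_def)
  then show ?thesis using assms by (auto simp: pyramids_def maxs_tmult)
qed

text \<open>After appending \<open>a\<close>, the other maximal letters that survive are those
  independent of \<open>a\<close>. This is the form in which pyramids come out of the Moebius
  inversion with \<open>Y = indep a\<close>.\<close>

lemma pyramids_1_eq:
  "pyramids a 1 = (\<lambda>v. v \<odot> letter a) ` {v \<in> traces. letters v \<subseteq> -{a} \<and> maxs v \<inter> indep a = {}}"
proof (intro equalityI subsetI)
  fix x assume x: "x \<in> pyramids a 1"
  then have "x \<noteq> tr []" "x \<in> traces" by (auto simp: pyramids_def)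
  then have "a \<in> maxs x" using x maxs_eq_empty_iff by (auto simp: pyramids_def)
  then obtain y where y: "y \<in> traces" "x = y \<odot> letter a" by (rule maxsE)
  then show "x \<in> (\<lambda>v. v \<odot> letter a) ` {v \<in> traces. letters v \<subseteq> -{a} \<and> maxs v \<inter> indep a = {}}"
    using x I_commute tcount_eq_0_iff[of y a] not_I_self[of a]
    by (intro image_eqI[of _ _ y]) (auto simp: pyramids_def maxs_tmult)
next
  fix x assume "x \<in> (\<lambda>v. v \<odot> letter a) ` {v \<in> traces. letters v \<subseteq> -{a} \<and> maxs v \<inter> indep a = {}}"
  then obtain v where "v \<in> traces" "letters v \<subseteq> -{a}" "maxs v \<inter> indep a = {}" "x = v \<odot> letter a"
    by auto
  moreover from this have "tcount a v = 0" using tcount_eq_0_iff by auto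
  ultimately show "x \<in> pyramids a 1"
    using I_commute by (auto simp: pyramids_def maxs_tmult)
qed

text \<open>No letter is independent of itself, so none commutes with all of \<open>v\<close>, and
  every maximal letter of \<open>u\<close> gets covered.\<close>

lemma tmult_full_pyramid:
  assumes "u \<in> traces" "v \<in> pyramids a n" "letters v = UNIV"
  shows "u \<odot> v \<in> pyramids a (tcount a u + n)"
proof -
  have "\<not> letters v \<subseteq> indep b" for b using assms(3) not_I_self[of b] by blast
  then show ?thesis using assms by (auto simp: pyramids_def maxs_tmult)
qed

text \<open>Walk along a dependence path from \<open>b\<close> to \<open>a\<close>: a letter put in
  front of a pyramid containing a dependent neighbour does not become maximal.\<close>

lemma pyramid_containing_letter:
  assumes "(b, a) \<in> (UNIV - I)\<^sup>*"
  shows "\<exists>v\<in>pyramids a 1. b \<in> letters v"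
  using assms
proof (induction rule: converse_rtrancl_induct)
  case base
  then show ?case by (intro bexI[of _ "letter a"]) (auto simp: pyramids_def)
next
  case (step b c)
  then obtain v where v: "v \<in> pyramids a 1" "c \<in> letters v" by blast
  show ?case
  proof (cases "b = a")
    case True
    then show ?thesis by (intro bexI[of _ "letter a"]) (auto simp: pyramids_def)
  next
    case False
    then have "letter b \<odot> v \<in> pyramids a 1"
      using v step by (auto simp: pyramids_def maxs_tmult)
    then show ?thesis using v pyramids_traces by (intro bexI[of _ "letter b \<odot> v"]) auto
  qed
qed

text \<open>A list of factors rather than one long pyramid, because the stopping identity advances
  by one element of \<open>pyramids a 1\<close> at a time.\<close>

lemma full_pyramid_list:
  assumes "\<And>b. (b, a) \<in> (UNIV - I)\<^sup>*"
  obtains vs where "set vs \<subseteq> pyramids a 1" "(\<Union>v\<in>set vs. letters v) = UNIV"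
proof -
  obtain v where v: "\<And>b. v b \<in> pyramids a 1 \<and> b \<in> letters (v b)"
    using pyramid_containing_letter[OF assms] by metis
  obtain bs where bs: "set bs = (UNIV :: 'a set)" using finite_list[OF finite] by auto
  have "x \<in> (\<Union>b. letters (v b))" for x using v by blast
  then show thesis using v bs by (intro that[of "map v bs"]) auto
qed

lemma countable_traces: "countable traces"
  unfolding carrier_trace_monoid by (rule countable_image)
    (metis countable_finite countable_lists finite lists_UNIV)

section \<open>Cylinders\<close>

lemma trace_chains_mono:
  assumes "x \<in> trace_chains I" "m \<le> n" shows "x m \<preceq> x n"
  using assms(2)
proof (induction rule: dec_induct)
  case base
  then show ?case using assms(1) by (auto simp: trace_chains_def intro: trace_le_refl)
next
  case (step n)
  then show ?case
    using assms(1) trace_le_trans[of "x m" I "x n" "x (Suc n)"] by (auto simp: trace_chains_def)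
qed

text \<open>Lets all arguments about \<open>\<xi>\<close> run on one representative chain; a
  comparison through other members of the two classes reduces to it by transitivity.\<close>

lemma boundary_chain:
  assumes "\<xi> \<in> boundary I"
  shows "\<exists>x\<in>trace_chains I. \<xi> = chain_rel I `` {x} \<and>
    (\<forall>u\<in>traces. \<xi> \<in> cylinder I u \<longleftrightarrow> (\<exists>n. u \<preceq> x n))"
proof -
  obtain x where x: "x \<in> trace_chains I" "\<xi> = chain_rel I `` {x}"
    using assms by (auto simp: boundary_def gen_traces_def elim: quotientE)
  have self: "x \<in> \<xi>" using x equiv_class_self[OF equiv_chain_rel] by blast
  have "\<xi> \<in> cylinder I u \<longleftrightarrow> (\<exists>n. u \<preceq> x n)" if u: "u \<in> traces" for u
  proof
    assume "\<xi> \<in> cylinder I u"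
    then obtain y z where yz: "((\<lambda>n. u), y) \<in> chain_rel I" "(x, z) \<in> chain_rel I" "chain_le I y z"
      by (auto simp: cylinder_def gen_trace_le_def embed_trace_def x)
    then obtain m k l where "u \<preceq> y m" "y m \<preceq> z k" "z k \<preceq> x l"
      unfolding chain_rel_def chain_le_def by blast
    moreover have "y m \<in> traces" "z k \<in> traces"
      using yz by (auto simp: chain_rel_def trace_chains_def)
    ultimately show "\<exists>n. u \<preceq> x n" using u trace_le_trans by metis
  next
    assume "\<exists>n. u \<preceq> x n"
    then have "chain_le I (\<lambda>n. u) x" by (simp add: chain_le_def)
    moreover have "(\<lambda>n. u) \<in> embed_trace I u"
      unfolding embed_trace_def
      using u trace_le_refl by (auto simp: chain_rel_def trace_chains_def chain_le_def)
    ultimately show "\<xi> \<in> cylinder I u"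
      using assms self by (auto simp: cylinder_def gen_trace_le_def)
  qed
  then show ?thesis using x by blast
qed

lemma cylinder_subset_boundary: "cylinder I u \<subseteq> boundary I"
  by (auto simp: cylinder_def)

lemma cylinder_Nil: "cylinder I (tr []) = boundary I"
proof -
  have "\<xi> \<in> cylinder I (tr [])" if "\<xi> \<in> boundary I" for \<xi>
  proof -
    obtain x where "x \<in> trace_chains I"
        "\<forall>u\<in>traces. \<xi> \<in> cylinder I u \<longleftrightarrow> (\<exists>n. u \<preceq> x n)"
      using boundary_chain[OF \<open>\<xi> \<in> boundary I\<close>] by blast
    moreover have "tr [] \<preceq> x 0"
      using \<open>x \<in> trace_chains I\<close>
      by (auto simp: trace_chains_def trace_le_def)
    ultimately show ?thesis by blast
  qed
  then show ?thesis using cylinder_subset_boundary by blast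
qed

lemma cylinder_antimono:
  assumes "u \<preceq> v" "u \<in> traces" "v \<in> traces" shows "cylinder I v \<subseteq> cylinder I u"
proof
  fix \<xi> assume \<xi>: "\<xi> \<in> cylinder I v"
  then have "\<xi> \<in> boundary I" by (simp add: cylinder_def)
  then obtain x :: "nat \<Rightarrow> 'a list set"
    where x: "\<forall>u\<in>traces. \<xi> \<in> cylinder I u \<longleftrightarrow> (\<exists>n. u \<preceq> x n)"
    using boundary_chain by blast
  then show "\<xi> \<in> cylinder I u" using \<xi> assms trace_le_trans by metis
qed

lemma cylinder_tmult_subset:
  "u \<in> traces \<Longrightarrow> v \<in> traces \<Longrightarrow> cylinder I (u \<odot> v) \<subseteq> cylinder I u"
  by (rule cylinder_antimono) auto

text \<open>A representative chain is increasing, so a late member dominates any finite number of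
  prefixes.\<close>

lemma cylinder_directed:
  assumes "finite F" "F \<subseteq> traces" "\<xi> \<in> boundary I" "\<And>u. u \<in> F \<Longrightarrow> \<xi> \<in> cylinder I u"
  shows "\<exists>x\<in>traces. \<xi> \<in> cylinder I x \<and> (\<forall>u\<in>F. u \<preceq> x)"
proof -
  obtain x where x: "x \<in> trace_chains I"
      "\<forall>u\<in>traces. \<xi> \<in> cylinder I u \<longleftrightarrow> (\<exists>n. u \<preceq> x n)"
    using boundary_chain[OF assms(3)] by blast
  have tr: "x n \<in> traces" for n using x(1) by (auto simp: trace_chains_def)
  have "\<exists>n. \<forall>u\<in>F. u \<preceq> x n"
    using assms(1,2,4)
  proof (induction F rule: finite_induct)
    case (insert v F)
    then obtain m where m: "\<forall>u\<in>F. u \<preceq> x m" by auto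
    have "v \<in> traces" "\<xi> \<in> cylinder I v" using insert.prems by auto
    then obtain k where k: "v \<preceq> x k" using x(2) by blast
    have "\<forall>u\<in>insert v F. u \<preceq> x (max m k)"
      using m k insert trace_chains_mono[OF x(1), of m "max m k"]
        trace_chains_mono[OF x(1), of k "max m k"] trace_le_trans
      by (metis insertE insert_subset max.cobounded1 max.cobounded2 subsetD)
    then show ?case by blast
  qed simp
  then obtain n where "\<forall>u\<in>F. u \<preceq> x n" by blast
  then show ?thesis using tr x trace_le_refl by blast
qed

text \<open>Here it matters that embedded finite traces are excluded: a chain that passes
  \<open>u\<close> but never gets strictly above it is equivalent to the constant chain
  \<open>u\<close>.\<close>

lemma cylinder_extend:
  assumes "\<xi> \<in> cylinder I u" "u \<in> traces"
  shows "\<exists>a. \<xi> \<in> cylinder I (u \<odot> letter a)"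
proof -
  have \<xi>: "\<xi> \<in> boundary I" using assms by (simp add: cylinder_def)
  obtain x where x: "x \<in> trace_chains I" "\<xi> = chain_rel I `` {x}"
      "\<forall>u\<in>traces. \<xi> \<in> cylinder I u \<longleftrightarrow> (\<exists>n. u \<preceq> x n)"
    using boundary_chain[OF \<xi>] by blast
  have tr: "x n \<in> traces" for n using x(1) by (auto simp: trace_chains_def)
  obtain k where k: "u \<preceq> x k" using assms x by blast
  have "\<not> chain_le I x (\<lambda>n. u)"
  proof
    assume "chain_le I x (\<lambda>n. u)"
    moreover have "chain_le I (\<lambda>n. u) x" using k by (auto simp: chain_le_def)
    moreover have "(\<lambda>n. u) \<in> trace_chains I"
      using assms trace_le_refl by (auto simp: trace_chains_def)
    ultimately have "(\<lambda>n. u, x) \<in> chain_rel I" using x by (auto simp: chain_rel_def)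
    then have "\<xi> = embed_trace I u"
      unfolding x embed_trace_def by (metis equiv_class_eq equiv_chain_rel)
    then show False using \<xi> assms by (auto simp: boundary_def)
  qed
  then obtain m where m: "\<not> x m \<preceq> u" by (auto simp: chain_le_def)
  define y where "y = x (max m k)"
  have "u \<preceq> y" "y \<noteq> u"
    using trace_chains_mono[OF x(1), of k "max m k"] trace_chains_mono[OF x(1), of m "max m k"]
      m k assms trace_le_trans unfolding y_def by (metis max.cobounded2, metis max.cobounded1)
  then obtain w where w: "w \<in> traces" "y = u \<odot> w" "w \<noteq> tr []"
    using assms(2) by (metis tleE tr_Nil_right)
  from w(1) obtain a v where "v \<in> traces" "w = letter a \<odot> v"
    by (cases rule: trace_cases) (use w in auto)
  then have "y = u \<odot> letter a \<odot> v" using w assms by (simp add: tmult_assoc)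
  then have "u \<odot> letter a \<preceq> x (max m k)" using \<open>v \<in> traces\<close> unfolding y_def by auto
  then show ?thesis using x(3) assms by blast
qed

lemma cylinder_Int:
  assumes "u \<in> traces" "v \<in> traces"
  shows "cylinder I u \<inter> cylinder I v \<in> insert {} (cylinder I ` traces)"
proof (cases "cylinder I u \<inter> cylinder I v = {}")
  case False
  then obtain \<xi> where "\<xi> \<in> boundary I" "\<xi> \<in> cylinder I u" "\<xi> \<in> cylinder I v"
    by (auto simp: cylinder_def)
  then obtain x where "x \<in> traces" "u \<preceq> x" "v \<preceq> x"
    using cylinder_directed[of "{u, v}" \<xi>] assms by auto
  then obtain w where w: "w \<in> traces" "u \<preceq> w" "v \<preceq> w"
      "\<And>y. y \<in> traces \<Longrightarrow> u \<preceq> y \<Longrightarrow> v \<preceq> y \<Longrightarrow> w \<preceq> y"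
    using trace_lub[OF assms] by blast
  have "cylinder I u \<inter> cylinder I v = cylinder I w"
  proof (intro equalityI subsetI)
    fix \<eta> assume \<eta>: "\<eta> \<in> cylinder I u \<inter> cylinder I v"
    then obtain y where y: "y \<in> traces" "\<eta> \<in> cylinder I y" "u \<preceq> y" "v \<preceq> y"
      using cylinder_directed[of "{u, v}" \<eta>] assms by (auto simp: cylinder_def)
    then show "\<eta> \<in> cylinder I w"
      using cylinder_antimono[of w y] w by auto
  qed (use cylinder_antimono[of u w] cylinder_antimono[of v w] w assms in auto)
  then show ?thesis using w by auto
qed simp

lemma Int_stable_cylinders: "Int_stable (insert {} (cylinder I ` traces))"
  unfolding Int_stable_def using cylinder_Int by blast

text \<open>By directedness a single finite prefix of \<open>\<xi>\<close> dominates
  \<open>u\<close> and every \<open>u \<odot> letter a\<close>; dividing it by \<open>u\<close>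
  reduces the claim to letters dividing a finite trace.\<close>

lemma cylinder_clique_iff:
  assumes "u \<in> traces" "\<xi> \<in> cylinder I u"
  shows "(\<forall>a\<in>c. \<xi> \<in> cylinder I (u \<odot> letter a)) \<longleftrightarrow>
    c \<in> cliques I \<and> \<xi> \<in> cylinder I (u \<odot> clique_trace I c)"
proof
  assume *: "\<forall>a\<in>c. \<xi> \<in> cylinder I (u \<odot> letter a)"
  have "\<xi> \<in> boundary I" using assms by (simp add: cylinder_def)
  then obtain x where x: "x \<in> traces" "\<xi> \<in> cylinder I x" "u \<preceq> x"
      "\<And>a. a \<in> c \<Longrightarrow> u \<odot> letter a \<preceq> x"
    using cylinder_directed[of "insert u ((\<lambda>a. u \<odot> letter a) ` c)" \<xi>] assms * by auto
  obtain w where w: "w \<in> traces" "x = u \<odot> w" using x(3) by (rule tleE)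
  then have "\<forall>a\<in>c. letter a \<preceq> w" using x(4) assms by (auto simp: tle_tmult_left_iff)
  then have c: "c \<in> cliques I" "clique_trace I c \<preceq> w"
    using letters_tle_clique_iff[OF w(1)] by auto
  then have "u \<odot> clique_trace I c \<preceq> x" using w assms by (auto simp: tle_tmult_left_iff)
  then show "c \<in> cliques I \<and> \<xi> \<in> cylinder I (u \<odot> clique_trace I c)"
    using c x assms cylinder_antimono[of "u \<odot> clique_trace I c" x] by auto
next
  assume *: "c \<in> cliques I \<and> \<xi> \<in> cylinder I (u \<odot> clique_trace I c)"
  then have "\<forall>a\<in>c. letter a \<preceq> clique_trace I c"
    using letters_tle_clique_iff[of "clique_trace I c" c] trace_le_refl[of _ I] by auto
  then have "cylinder I (u \<odot> clique_trace I c) \<subseteq> cylinder I (u \<odot> letter a)" if "a \<in> c" for a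
    using * that assms by (intro cylinder_antimono) (auto simp: tle_tmult_left_iff)
  then show "\<forall>a\<in>c. \<xi> \<in> cylinder I (u \<odot> letter a)" using * by blast
qed

text \<open>A common point would give \<open>v\<close> and \<open>w\<close> a common upper bound,
  after cancelling \<open>u\<close>.\<close>

lemma cylinder_pyramids_disjoint:
  assumes "u \<in> traces"
  shows "disjoint_family_on (\<lambda>v. cylinder I (u \<odot> v)) (pyramids a n)"
  unfolding disjoint_family_on_def
proof (intro ballI impI, rule ccontr)
  fix v w assume vw: "v \<in> pyramids a n" "w \<in> pyramids a n" "v \<noteq> w"
    and "cylinder I (u \<odot> v) \<inter> cylinder I (u \<odot> w) \<noteq> {}"
  then obtain \<xi> where \<xi>: "\<xi> \<in> cylinder I (u \<odot> v)" "\<xi> \<in> cylinder I (u \<odot> w)" by blast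
  have tr: "v \<in> traces" "w \<in> traces" using vw pyramids_traces by auto
  have "\<xi> \<in> boundary I" using \<xi> by (simp add: cylinder_def)
  then obtain x where x: "x \<in> traces" "u \<odot> v \<preceq> x" "u \<odot> w \<preceq> x"
    using cylinder_directed[of "{u \<odot> v, u \<odot> w}" \<xi>] assms \<xi> tr by auto
  obtain y where "y \<in> traces" "x = u \<odot> (v \<odot> y)"
    using x(2) assms tr by (auto elim!: tleE simp: tmult_assoc)
  then have "v \<preceq> v \<odot> y" "w \<preceq> v \<odot> y"
    using x assms tr by (auto simp: tle_tmult_left_iff)
  then show False using pyramids_common_upper_bound vw by blast
qed

end

section \<open>Bernoulli measures and the weights of cylinders\<close>

locale bernoulli = independence I for I :: "('a::finite \<times> 'a) set" +
  fixes P :: "'a gen_trace measure"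
  assumes irreducible: "irreducible_trace_monoid I" and bernoulli: "bernoulli_measure I P"
begin

sublocale prob_space P
  using bernoulli by (simp add: bernoulli_measure_def)

abbreviation cyl :: "'a list set \<Rightarrow> 'a gen_trace set" where "cyl \<equiv> cylinder I"

definition weight :: "'a list set \<Rightarrow> real" where "weight u = measure P (cyl u)"

lemma space_P: "space P = boundary I" and sets_P: "sets P = boundary_algebra I"
  using bernoulli by (auto simp: bernoulli_measure_def)

lemma cyl_sets [measurable (raw), simp, intro]: "u \<in> traces \<Longrightarrow> cyl u \<in> sets P"
  unfolding sets_P boundary_algebra_def by (auto intro: sigma_sets.Basic)

lemma weight_pos: "u \<in> traces \<Longrightarrow> weight u > 0"
  using bernoulli by (auto simp: bernoulli_measure_def weight_def)

lemma weight_nonneg [simp]: "0 \<le> weight u"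
  by (simp add: weight_def)

lemma weight_tmult: "u \<in> traces \<Longrightarrow> v \<in> traces \<Longrightarrow> weight (u \<odot> v) = weight u * weight v"
  using bernoulli by (auto simp: bernoulli_measure_def weight_def)

lemma weight_Nil [simp]: "weight (tr []) = 1"
  unfolding weight_def cylinder_Nil by (metis prob_space space_P)

lemma emeasure_cyl: "emeasure P (cyl u) = ennreal (weight u)"
  by (simp add: weight_def emeasure_eq_measure)

section \<open>Averages over cylinders are harmonic\<close>

text \<open>Expand the product over all letters \<open>a\<close> of one minus the indicator of
  \<open>cyl (u \<odot> letter a)\<close>. It vanishes because \<open>\<xi>\<close> continues
  \<open>u\<close> by some letter, and the sets of letters that are not cliques contribute
  zero.\<close>

lemma inclusion_exclusion_cylinders:
  assumes u: "u \<in> traces" and \<xi>: "\<xi> \<in> cyl u"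
  shows "(\<Sum>c\<in>cliques I. (- 1) ^ card c * indicat_real (cyl (u \<odot> clique_trace I c)) \<xi>) = 0"
proof -
  let ?i = "\<lambda>a. indicat_real (cyl (u \<odot> letter a)) \<xi>"
  obtain a where a: "\<xi> \<in> cyl (u \<odot> letter a)" using cylinder_extend[OF \<xi> u] by blast
  have "(\<Prod>a\<in>UNIV. - ?i a + 1) = 0"
    using a by (intro prod_zero bexI[of _ a]) auto
  moreover have "(\<Prod>a\<in>UNIV. - ?i a + 1) = (\<Sum>c\<in>UNIV. (- 1) ^ card c * (\<Prod>a\<in>c. ?i a))"
    by (subst prod_add) (auto simp: prod_uminus)
  moreover have "\<dots> = (\<Sum>c\<in>cliques I. (- 1) ^ card c * indicat_real (cyl (u \<odot> clique_trace I c)) \<xi>)"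
  proof (rule sum.mono_neutral_cong_right)
    show "\<forall>c\<in>UNIV - cliques I. (- 1) ^ card c * (\<Prod>a\<in>c. ?i a) = 0"
      using cylinder_clique_iff[OF u \<xi>] by (auto simp: prod_zero_iff indicator_def)
    show "(- 1) ^ card c * (\<Prod>a\<in>c. ?i a)
        = (- 1) ^ card c * indicat_real (cyl (u \<odot> clique_trace I c)) \<xi>" if "c \<in> cliques I" for c
    proof (cases "\<xi> \<in> cyl (u \<odot> clique_trace I c)")
      case True
      then have "\<forall>a\<in>c. ?i a = 1" using cylinder_clique_iff[OF u \<xi>, of c] that by auto
      then show ?thesis using True by simp
    next
      case False
      then obtain b where "b \<in> c" "?i b = 0"
        using cylinder_clique_iff[OF u \<xi>, of c] that by (auto simp: indicator_def)
      then have "(\<Prod>a\<in>c. ?i a) = 0" by (auto intro: prod_zero)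
      then show ?thesis using False by simp
    qed
  qed auto
  ultimately show ?thesis by (simp only:)
qed

lemma integral_cylinder_cliques:
  fixes g :: "'a gen_trace \<Rightarrow> real"
  assumes u: "u \<in> traces" and g: "integrable P g"
  shows "(\<Sum>c\<in>cliques I. (- 1) ^ card c * (LINT x:cyl (u \<odot> clique_trace I c)|P. g x)) = 0"
proof -
  have int: "integrable P (\<lambda>x. indicator (cyl (u \<odot> clique_trace I c)) x *\<^sub>R g x)"
    if "c \<in> cliques I" for c
    using that u g by (intro integrable_mult_indicator) auto
  have "(\<Sum>c\<in>cliques I. (- 1) ^ card c * (LINT x:cyl (u \<odot> clique_trace I c)|P. g x))
    = (LINT x|P. (\<Sum>c\<in>cliques I. (- 1) ^ card c * (indicator (cyl (u \<odot> clique_trace I c)) x *\<^sub>R g x)))"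
    unfolding set_lebesgue_integral_def
    by (subst Bochner_Integration.integral_sum) (use int in auto)
  also have "\<dots> = (LINT x|P. 0)"
  proof (rule Bochner_Integration.integral_cong)
    fix x
    have "(\<Sum>c\<in>cliques I. (- 1) ^ card c * indicat_real (cyl (u \<odot> clique_trace I c)) x) = 0"
    proof (cases "x \<in> cyl u")
      case False
      then show ?thesis
        using u cylinder_tmult_subset[OF u] by (intro sum.neutral) (auto simp: indicator_def)
    qed (rule inclusion_exclusion_cylinders[OF u])
    then have "(\<Sum>c\<in>cliques I. (- 1) ^ card c * indicat_real (cyl (u \<odot> clique_trace I c)) x) * g x = 0"
      by simp
    then show "(\<Sum>c\<in>cliques I. (- 1) ^ card c * (indicator (cyl (u \<odot> clique_trace I c)) x *\<^sub>R g x)) = 0"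
      unfolding sum_distrib_right by (simp only: real_scaleR_def mult.assoc)
  qed simp
  finally show ?thesis by simp
qed

text \<open>Multiplying the equation at \<open>u\<close> by the positive number
  \<open>weight u\<close> merges the weights of \<open>u\<close> and of the clique, which leaves the
  integrated inclusion-exclusion identity.\<close>

lemma moebius_harmonic_average:
  fixes g :: "'a gen_trace \<Rightarrow> real"
  assumes g: "integrable P g"
    and h: "\<And>u. u \<in> traces \<Longrightarrow> weight u * h u = (LINT x:cyl u|P. g x)"
  shows "moebius_harmonic I P h"
  unfolding moebius_harmonic_def
proof
  fix u assume u: "u \<in> traces"
  have "weight u * (\<Sum>c\<in>cliques I. (- 1) ^ card c * weight (clique_trace I c) * h (u \<odot> clique_trace I c))
    = (\<Sum>c\<in>cliques I. (- 1) ^ card c * (weight (u \<odot> clique_trace I c) * h (u \<odot> clique_trace I c)))"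
    unfolding sum_distrib_left using u by (intro sum.cong) (auto simp: weight_tmult)
  also have "\<dots> = (\<Sum>c\<in>cliques I. (- 1) ^ card c * (LINT x:cyl (u \<odot> clique_trace I c)|P. g x))"
    using u by (intro sum.cong) (auto simp: h)
  also have "\<dots> = 0" by (rule integral_cylinder_cliques[OF u g])
  finally show "(\<Sum>c\<in>cliques I. (- 1) ^ card c * measure P (cyl (clique_trace I c))
      * h (u \<odot> clique_trace I c)) = 0"
    using weight_pos[OF u] by (simp add: weight_def)
qed

text \<open>Used for \<open>K = 1\<close> to show that pyramid cylinders exhaust the measure, and
  for shifting a bounded harmonic function into the nonnegative range.\<close>

lemma moebius_harmonic_const: "moebius_harmonic I P (\<lambda>u. K)"
proof (rule moebius_harmonic_average)
  show "weight u * K = (LINT x:cyl u|P. K)" if "u \<in> traces" for u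
    using that cylinder_subset_boundary[of u]
    by (simp add: weight_def set_lebesgue_integral_def Int_absorb2 space_P)
qed simp

lemma moebius_harmonic_linear:
  assumes "moebius_harmonic I P h" "moebius_harmonic I P k"
  shows "moebius_harmonic I P (\<lambda>u. s * h u + t * k u)"
proof -
  have "(\<Sum>c\<in>cliques I. (- 1) ^ card c * measure P (cyl (clique_trace I c))
          * (s * h (u \<odot> clique_trace I c) + t * k (u \<odot> clique_trace I c)))
      = s * (\<Sum>c\<in>cliques I. (- 1) ^ card c * measure P (cyl (clique_trace I c)) * h (u \<odot> clique_trace I c))
      + t * (\<Sum>c\<in>cliques I. (- 1) ^ card c * measure P (cyl (clique_trace I c)) * k (u \<odot> clique_trace I c))"
    for u by (simp add: sum_distrib_left sum.distrib[symmetric] algebra_simps)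
  then show ?thesis using assms by (simp add: moebius_harmonic_def)
qed

section \<open>Uniqueness\<close>

text \<open>Dynkin's argument on an intersection-stable generator. The empty set joins the generator
  because cylinders may be disjoint, and complements use that the whole boundary is the cylinder of
  the empty trace.\<close>

lemma AE_eq_if_cylinder_integrals_eq:
  fixes f g :: "'a gen_trace \<Rightarrow> real"
  assumes f: "integrable P f" and g: "integrable P g"
    and eq: "\<And>u. u \<in> traces \<Longrightarrow> (LINT x:cyl u|P. f x) = (LINT x:cyl u|P. g x)"
  shows "AE x in P. f x = g x"
proof (rule density_unique_real[OF f g])
  let ?G = "insert {} (cylinder I ` traces)"
  have si: "set_integrable P A f" "set_integrable P A g" if "A \<in> sets P" for A
    unfolding set_integrable_def using that f g by (auto simp only: intro: integrable_mult_indicator)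
  have sets_G: "sets P = sigma_sets (boundary I) ?G"
    unfolding sets_P boundary_algebra_def
    by (intro sigma_sets_eqI) (auto intro: sigma_sets.Empty)
  have G_sub: "?G \<subseteq> Pow (boundary I)" using cylinder_subset_boundary by auto
  have top: "boundary I \<in> sets P" by (metis sets.top space_P)
  fix A assume "A \<in> sets P"
  then have "A \<in> sigma_sets (boundary I) ?G" by (simp add: sets_G)
  from Int_stable_cylinders G_sub this
  show "(LINT x:A|P. f x) = (LINT x:A|P. g x)"
  proof (induction rule: sigma_sets_induct_disjoint)
    case (basic A)
    then show ?case using eq by (auto simp: set_lebesgue_integral_def)
  next
    case empty
    then show ?case by (simp add: set_lebesgue_integral_def)
  next
    case (compl A)
    then have A: "A \<in> sets P" by (simp add: sets_G)
    have "(LINT x:boundary I - A|P. h x) = (LINT x:boundary I|P. h x) - (LINT x:A|P. h x)"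
      if h: "integrable P h" for h :: "'a gen_trace \<Rightarrow> real"
    proof -
      have sub: "A \<subseteq> boundary I" using sets.sets_into_space[OF A] space_P by simp
      have "(LINT x:(boundary I - A) \<union> A|P. h x)
          = (LINT x:boundary I - A|P. h x) + (LINT x:A|P. h x)"
      proof (rule set_integral_Un)
        show "set_integrable P (boundary I - A) h" "set_integrable P A h"
          unfolding set_integrable_def using A top h by (auto simp only: intro: integrable_mult_indicator)
      qed auto
      moreover have "(boundary I - A) \<union> A = boundary I" using sub by auto
      ultimately show ?thesis by simp
    qed
    then show ?case using compl f g eq[of "tr []"] by (simp add: cylinder_Nil)
  next
    case (union A)
    then have A: "A i \<in> sets P" for i by (auto simp: sets_G)
    have U: "(\<Union>i. A i) \<in> sets P" using A by auto
    have "(LINT x:(\<Union>i. A i)|P. h x) = (\<Sum>i. (LINT x:A i|P. h x))"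
      if "set_integrable P (\<Union>i. A i) h" for h :: "'a gen_trace \<Rightarrow> real"
      by (rule lebesgue_integral_countable_add)
        (use A union that in \<open>auto simp: disjoint_family_on_def\<close>)
    then show ?case using si[OF U] union by simp
  qed
qed

end

lemma sum_alternating_Pow:
  assumes "finite A"
  shows "(\<Sum>c\<in>Pow A. (- 1) ^ card c :: real) = (if A = {} then 1 else 0)"
proof -
  have "(\<Sum>c\<in>Pow A. (- 1) ^ card c :: real) = (\<Prod>x\<in>A. - 1 + 1)"
    using assms by (subst prod_add) auto
  then show ?thesis using assms by (auto simp: card_gt_0_iff)
qed

lemma has_sum_sum:
  fixes f :: "'b \<Rightarrow> 'c \<Rightarrow> real"
  assumes "finite S" "\<And>i. i \<in> S \<Longrightarrow> (f i has_sum s i) A"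
  shows "((\<lambda>x. \<Sum>i\<in>S. f i x) has_sum (\<Sum>i\<in>S. s i)) A"
  using assms by (induction S rule: finite_induct) (auto intro: has_sum_add has_sum_0)

context bernoulli
begin

section \<open>Stopping at the first occurrence of a letter\<close>

definition over :: "'a set \<Rightarrow> 'a list set set" where
  "over X = {x \<in> traces. letters x \<subseteq> X}"

lemma overD: "x \<in> over X \<Longrightarrow> x \<in> traces" "x \<in> over X \<Longrightarrow> letters x \<subseteq> X"
  by (auto simp: over_def)

lemma sum_weight_pyramids_le:
  assumes "finite F" "F \<subseteq> pyramids a n"
  shows "(\<Sum>v\<in>F. weight v) \<le> 1"
proof -
  have tr: "v \<in> traces" if "v \<in> F" for v using assms that pyramids_traces by blast
  have "disjoint_family_on (\<lambda>v. cyl (tr [] \<odot> v)) F"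
    using cylinder_pyramids_disjoint[of "tr []" a n] assms
    by (auto simp: disjoint_family_on_def)
  then have "disjoint_family_on cyl F"
    using tr by (auto simp: disjoint_family_on_def)
  then have "(\<Sum>v\<in>F. weight v) = measure P (\<Union>v\<in>F. cyl v)"
    unfolding weight_def using assms tr
    by (intro finite_measure_finite_Union[symmetric]) auto
  then show ?thesis by simp
qed

text \<open>A dependence path from a letter outside \<open>X\<close> to one inside has an edge that
  crosses the border of \<open>X\<close>.\<close>

lemma dependent_letter_outside:
  assumes "X \<noteq> UNIV" "X \<noteq> {}"
  obtains a b where "a \<notin> X" "b \<in> X" "(a, b) \<notin> I"
proof -
  obtain c d where "c \<notin> X" "d \<in> X" using assms by blast
  moreover have "(c, d) \<in> (UNIV - I)\<^sup>*"
    using irreducible by (simp add: irreducible_trace_monoid_def)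
  moreover have "(c, d) \<in> (UNIV - I)\<^sup>* \<Longrightarrow> d \<in> X \<Longrightarrow> c \<notin> X \<Longrightarrow>
      \<exists>a b. a \<notin> X \<and> b \<in> X \<and> (a, b) \<notin> I" for c d
    by (induction rule: rtrancl_induct) auto
  ultimately show thesis using that by blast
qed

text \<open>With \<open>a \<notin> X\<close>, a trace over \<open>X\<close> factors as \<open>v \<odot> w\<close> with \<open>v \<odot> a\<close> a pyramid
  and \<open>w\<close> over \<open>X \<inter> indep a\<close>. The weights of the pyramids sum to at most \<open>1\<close>, and
  by irreducibility \<open>a\<close> can be chosen such that \<open>X \<inter> indep a\<close> is smaller than \<open>X\<close>.\<close>

lemma summable_weight_over:
  assumes "X \<noteq> UNIV"
  shows "weight summable_on over X"
  using finite[of X] assms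
proof (induction X rule: finite_psubset_induct)
  case (psubset X)
  show ?case
  proof (cases "X = {}")
    case True
    have "over X \<subseteq> {tr []}"
      unfolding True over_def using maxs_eq_empty_iff maxs_subset_letters by blast
    then show ?thesis by (meson finite.emptyI finite_insert finite_subset summable_on_finite)
  next
    case False
    obtain a b where ab: "a \<notin> X" "b \<in> X" "(a, b) \<notin> I"
      by (rule dependent_letter_outside[OF psubset.prems False])
    define A where "A = {v \<in> over X. maxs v \<inter> indep a = {}}"
    define B where "B = over (X \<inter> indep a)"
    have tr: "v \<in> traces" if "v \<in> A \<union> B" for v using that by (auto simp: A_def B_def over_def)
    have B: "weight summable_on B"
      unfolding B_def using ab by (intro psubset.IH) auto
    have A: "weight summable_on A"
    proof (rule nonneg_bdd_above_summable_on)
      \<comment> \<open>Appending \<open>a\<close> maps \<open>F\<close> injectively into the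
        pyramids and multiplies every weight by \<open>weight (letter a)\<close>.\<close>
      have "sum weight F \<le> 1 / weight (letter a)" if F: "F \<subseteq> A" "finite F" for F
      proof -
        let ?m = "\<lambda>v. v \<odot> letter a"
        have inj: "inj_on ?m F"
          using F tr tmult_right_cancel[of _ "letter a"] by (intro inj_onI) blast
        have "?m ` F \<subseteq> pyramids a 1"
          unfolding pyramids_1_eq using F ab by (auto simp: A_def over_def)
        then have "sum weight (?m ` F) \<le> 1" using F by (intro sum_weight_pyramids_le) auto
        also have "sum weight (?m ` F) = sum weight F * weight (letter a)"
          unfolding sum.reindex[OF inj] sum_distrib_right
          using F tr by (intro sum.cong) (auto simp: weight_tmult)
        finally show ?thesis using weight_pos[of "letter a"] by (simp add: field_simps)
      qed
      then show "bdd_above (sum weight ` {F. F \<subseteq> A \<and> finite F})"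
        by (intro bdd_aboveI[of _ "1 / weight (letter a)"]) auto
    qed simp
    have AB: "(\<lambda>(v, w). weight v * weight w) summable_on A \<times> B"
    proof (rule summable_on_SigmaI)
      show "((\<lambda>w. case (v, w) of (v, w) \<Rightarrow> weight v * weight w)
          has_sum weight v * infsum weight B) B" for v
        using has_sum_cmult_right[OF has_sum_infsum[OF B]] by simp
      show "(\<lambda>v. weight v * infsum weight B) summable_on A"
        by (intro summable_on_cmult_left A)
    qed simp
    have "\<exists>p\<in>A \<times> B. fst p \<odot> snd p = x" if x: "x \<in> over X" for x
    proof -
      obtain v w where "v \<in> traces" "w \<in> traces" "x = v \<odot> w" "maxs v \<inter> indep a = {}"
          "letters w \<subseteq> indep a"
        using strip_maximal[OF overD(1)[OF x]] by blast
      then show ?thesis using x by (intro bexI[of _ "(v, w)"]) (auto simp: A_def B_def over_def)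
    qed
    \<comment> \<open>A choice of factorization suffices: \<open>s\<close> is injective since
      multiplying the factors recovers \<open>x\<close>, and summability over all pairs passes to
      its image.\<close>
    then obtain s where s: "\<And>x. x \<in> over X \<Longrightarrow> s x \<in> A \<times> B \<and> fst (s x) \<odot> snd (s x) = x"
      by metis
    have inj: "inj_on s (over X)" by (metis inj_onI s)
    have "(\<lambda>(v, w). weight v * weight w) summable_on s ` over X"
      by (rule summable_on_subset_banach[OF AB]) (use s in blast)
    then have "((\<lambda>(v, w). weight v * weight w) \<circ> s) summable_on over X"
      by (simp add: summable_on_reindex[OF inj])
    moreover have "((\<lambda>(v, w). weight v * weight w) \<circ> s) x = weight x" if x: "x \<in> over X" for x
    proof -
      have "fst (s x) \<in> traces" "snd (s x) \<in> traces" using s[OF x] tr by auto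
      then show ?thesis
        using s[OF x] weight_tmult[of "fst (s x)" "snd (s x)"] by (simp add: case_prod_unfold)
    qed
    ultimately show ?thesis using summable_on_cong by metis
  qed
qed

text \<open>For fixed \<open>c\<close>, substituting \<open>x = w \<odot> clique_trace I c\<close>
  gives the sum over those \<open>x\<close> whose maximal letters include \<open>c\<close>; it stays
  over \<open>X\<close> since \<open>c \<subseteq> Y \<subseteq> X\<close>. After exchanging the
  sums, \<open>x\<close> has as coefficient the alternating sum over the subsets of
  \<open>maxs x \<inter> Y\<close>, all of which are cliques.\<close>

lemma moebius_inversion_over:
  fixes G :: "'a list set \<Rightarrow> real"
  assumes "Y \<subseteq> X" and G: "G summable_on over X"
  shows "((\<lambda>w. \<Sum>c\<in>cliques I \<inter> Pow Y. (- 1) ^ card c * G (w \<odot> clique_trace I c))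
    has_sum (\<Sum>\<^sub>\<infinity>x\<in>{x \<in> over X. maxs x \<inter> Y = {}}. G x)) (over X)"
proof -
  let ?C = "cliques I \<inter> Pow Y"
  have reindexed: "((\<lambda>w. G (w \<odot> clique_trace I c)) has_sum
      (\<Sum>\<^sub>\<infinity>x\<in>over X. if c \<subseteq> maxs x then G x else 0)) (over X)" if c: "c \<in> ?C" for c
  proof -
    have cl: "c \<in> cliques I" "clique_trace I c \<in> traces" using c by auto
    have bij: "bij_betw (\<lambda>w. w \<odot> clique_trace I c) (over X) {x \<in> over X. c \<subseteq> maxs x}"
    proof (rule bij_betw_imageI)
      show "inj_on (\<lambda>w. w \<odot> clique_trace I c) (over X)"
        using cl tmult_right_cancel[of _ "clique_trace I c"] by (intro inj_onI) (blast dest: overD)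
      show "(\<lambda>w. w \<odot> clique_trace I c) ` over X = {x \<in> over X. c \<subseteq> maxs x}"
      proof (intro equalityI subsetI)
        fix x assume "x \<in> (\<lambda>w. w \<odot> clique_trace I c) ` over X"
        then obtain w where w: "w \<in> over X" "x = w \<odot> clique_trace I c" by blast
        then have "c \<subseteq> maxs x" using clique_subset_maxs_iff[OF cl(1), of x] cl overD by auto
        then show "x \<in> {x \<in> over X. c \<subseteq> maxs x}" using w c cl assms(1) by (auto simp: over_def)
      next
        fix x assume x: "x \<in> {x \<in> over X. c \<subseteq> maxs x}"
        then obtain w where "w \<in> traces" "x = w \<odot> clique_trace I c"
          using clique_subset_maxs_iff[OF cl(1), of x] overD by auto
        then show "x \<in> (\<lambda>w. w \<odot> clique_trace I c) ` over X"
          using x cl by (auto simp: over_def)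
      qed
    qed
    have "G summable_on {x \<in> over X. c \<subseteq> maxs x}"
      by (rule summable_on_subset_banach[OF G]) auto
    then have "(G has_sum (\<Sum>\<^sub>\<infinity>x\<in>{x \<in> over X. c \<subseteq> maxs x}. G x)) {x \<in> over X. c \<subseteq> maxs x}"
      by (rule has_sum_infsum)
    moreover have "(\<Sum>\<^sub>\<infinity>x\<in>{x \<in> over X. c \<subseteq> maxs x}. G x)
        = (\<Sum>\<^sub>\<infinity>x\<in>over X. if c \<subseteq> maxs x then G x else 0)"
      by (rule infsum_cong_neutral) auto
    ultimately show ?thesis using has_sum_reindex_bij_betw[OF bij, of G] by simp
  qed
  have ind: "(\<lambda>x. if c \<subseteq> maxs x then G x else 0) summable_on over X" for c
  proof -
    have "G summable_on {x \<in> over X. c \<subseteq> maxs x}"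
      by (rule summable_on_subset_banach[OF G]) auto
    then show ?thesis
      by (rule summable_on_cong_neutral[THEN iffD1, rotated -1]) auto
  qed
  have "((\<lambda>w. \<Sum>c\<in>?C. (- 1) ^ card c * G (w \<odot> clique_trace I c)) has_sum
     (\<Sum>c\<in>?C. (- 1) ^ card c * (\<Sum>\<^sub>\<infinity>x\<in>over X. if c \<subseteq> maxs x then G x else 0))) (over X)"
    by (intro has_sum_sum has_sum_cmult_right reindexed) auto
  moreover have "(\<Sum>c\<in>?C. (- 1) ^ card c * (\<Sum>\<^sub>\<infinity>x\<in>over X. if c \<subseteq> maxs x then G x else 0))
      = (\<Sum>c\<in>?C. \<Sum>\<^sub>\<infinity>x\<in>over X. (- 1) ^ card c * (if c \<subseteq> maxs x then G x else 0))"
    by (simp add: infsum_cmult_right ind)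
  moreover have "\<dots> = (\<Sum>\<^sub>\<infinity>x\<in>over X. \<Sum>c\<in>?C. (- 1) ^ card c * (if c \<subseteq> maxs x then G x else 0))"
    by (intro infsumI[symmetric] has_sum_sum has_sum_infsum summable_on_cmult_right ind) auto
  moreover have "\<dots> = (\<Sum>\<^sub>\<infinity>x\<in>{x \<in> over X. maxs x \<inter> Y = {}}. G x)"
  proof (rule infsum_cong_neutral)
    have eq: "(\<Sum>c\<in>?C. (- 1) ^ card c * (if c \<subseteq> maxs x then G x else 0))
        = (if maxs x \<inter> Y = {} then G x else 0)" if x: "x \<in> over X" for x
    proof -
      have "(\<Sum>c\<in>?C. (- 1) ^ card c * (if c \<subseteq> maxs x then G x else 0))
          = (\<Sum>c\<in>Pow (maxs x \<inter> Y). (- 1) ^ card c * G x)"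
        using subset_clique[OF maxs_in_cliques[OF overD(1)[OF x]]]
        by (intro sum.mono_neutral_cong_right) auto
      also have "\<dots> = (if maxs x \<inter> Y = {} then G x else 0)"
        by (subst sum_distrib_right[symmetric], subst sum_alternating_Pow) auto
      finally show ?thesis .
    qed
    show "(\<Sum>c\<in>?C. (- 1) ^ card c * (if c \<subseteq> maxs x then G x else 0)) = 0"
      if "x \<in> over X - {x \<in> over X. maxs x \<inter> Y = {}}" for x
      using that eq[of x] by auto
    show "(\<Sum>c\<in>?C. (- 1) ^ card c * (if c \<subseteq> maxs x then G x else 0)) = G x"
      if "x \<in> over X \<inter> {x \<in> over X. maxs x \<inter> Y = {}}" for x
      using that eq[of x] by auto
  qed auto
  ultimately show ?thesis by simp
qed

text \<open>Two inversions over the traces avoiding \<open>a\<close>, one with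
  \<open>Y = - {a}\<close> and one with \<open>Y = indep a\<close>, are applied to termwise equal
  families; equating their sums gives the identity.\<close>

theorem harmonic_stopping:
  assumes harm: "moebius_harmonic I P h" and bdd: "\<And>u. u \<in> traces \<Longrightarrow> \<bar>h u\<bar> \<le> K"
    and u: "u \<in> traces"
  shows "((\<lambda>v. weight v * h (u \<odot> v)) has_sum h u) (pyramids a 1)"
proof -
  define F where "F v = weight v * h (u \<odot> v)" for v
  let ?X = "- {a}"
  let ?ct = "clique_trace I"
  have sub: "weight summable_on over ?X" by (rule summable_weight_over) auto
  have Fb: "norm (F v) \<le> K * weight v" if "v \<in> traces" for v
    using mult_left_mono[OF bdd[of "u \<odot> v"], of "weight v"] that u
    by (simp add: F_def abs_mult mult.commute)
  have "(\<lambda>v. K * weight v) summable_on over ?X" by (intro summable_on_cmult_right sub)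
  then have F: "F summable_on over ?X"
    using Fb overD(1)
    by (intro abs_summable_summable[OF Infinite_Sum.abs_summable_on_comparison_test'[of _ _ F]]) auto
  have Fa: "(\<lambda>v. F (v \<odot> letter a)) summable_on over ?X"
  proof (rule abs_summable_summable, rule Infinite_Sum.abs_summable_on_comparison_test')
    show "(\<lambda>v. K * weight (letter a) * weight v) summable_on over ?X"
      by (intro summable_on_cmult_right sub)
    show "norm (F (v \<odot> letter a)) \<le> K * weight (letter a) * weight v" if "v \<in> over ?X" for v
      using Fb[of "v \<odot> letter a"] overD(1)[OF that] by (simp add: weight_tmult mult_ac)
  qed
  \<comment> \<open>Harmonicity at \<open>u \<odot> w\<close>, multiplied by
    \<open>weight w\<close>. The cliques containing \<open>a\<close> are moved to the right-hand
    side, where dropping \<open>a\<close> absorbs the minus sign.\<close>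
  have balance: "(\<Sum>c\<in>cliques I \<inter> Pow ?X. (- 1) ^ card c * F (w \<odot> ?ct c))
      = (\<Sum>c\<in>cliques I \<inter> Pow (indep a). (- 1) ^ card c * F (w \<odot> ?ct c \<odot> letter a))"
    if w: "w \<in> traces" for w
  proof -
    have img: "{c \<in> cliques I. a \<in> c} = insert a ` (cliques I \<inter> Pow (indep a))"
    proof (intro equalityI subsetI)
      fix c assume c: "c \<in> {c \<in> cliques I. a \<in> c}"
      then have "c = insert a (c - {a})" "c - {a} \<in> cliques I \<inter> Pow (indep a)"
        using insert_in_cliques_iff[of a "c - {a}"] by (auto simp: insert_absorb)
      then show "c \<in> insert a ` (cliques I \<inter> Pow (indep a))" by blast
    next
      fix c assume "c \<in> insert a ` (cliques I \<inter> Pow (indep a))"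
      then obtain d where "c = insert a d" "d \<in> cliques I" "d \<subseteq> indep a" by auto
      moreover have "a \<notin> d" using \<open>d \<subseteq> indep a\<close> not_I_self[of a] by blast
      ultimately show "c \<in> {c \<in> cliques I. a \<in> c}" using insert_in_cliques_iff by auto
    qed
    have na: "a \<notin> c" if "c \<in> Pow (indep a)" for c using that not_I_self[of a] by blast
    have inj: "inj_on (insert a) (cliques I \<inter> Pow (indep a))"
      using na by (intro inj_onI) (metis IntE insert_ident)
    have "0 = weight w * (\<Sum>c\<in>cliques I. (- 1) ^ card c * weight (?ct c) * h (u \<odot> w \<odot> ?ct c))"
      using harm u w by (auto simp: moebius_harmonic_def weight_def)
    also have "\<dots> = (\<Sum>c\<in>cliques I. (- 1) ^ card c * F (w \<odot> ?ct c))"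
      unfolding sum_distrib_left F_def
      using u w by (intro sum.cong) (auto simp: weight_tmult tmult_assoc)
    also have "\<dots> = (\<Sum>c\<in>(cliques I \<inter> Pow ?X) \<union> {c \<in> cliques I. a \<in> c}. (- 1) ^ card c * F (w \<odot> ?ct c))"
      by (rule sum.cong) auto
    also have "\<dots> = (\<Sum>c\<in>cliques I \<inter> Pow ?X. (- 1) ^ card c * F (w \<odot> ?ct c))
        + (\<Sum>c\<in>{c \<in> cliques I. a \<in> c}. (- 1) ^ card c * F (w \<odot> ?ct c))"
      by (rule sum.union_disjoint) auto
    also have "(\<Sum>c\<in>{c \<in> cliques I. a \<in> c}. (- 1) ^ card c * F (w \<odot> ?ct c))
        = (\<Sum>c\<in>cliques I \<inter> Pow (indep a). - ((- 1) ^ card c * F (w \<odot> ?ct c \<odot> letter a)))"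
      unfolding img sum.reindex[OF inj] o_def
    proof (rule sum.cong)
      fix c assume c: "c \<in> cliques I \<inter> Pow (indep a)"
      then have "a \<notin> c" "insert a c \<in> cliques I"
        using na insert_in_cliques_iff[of a c] by auto
      then show "(- 1) ^ card (insert a c) * F (w \<odot> ?ct (insert a c))
          = - ((- 1) ^ card c * F (w \<odot> ?ct c \<odot> letter a))"
        using clique_trace_insert(1)[of a c] c w by (simp add: tmult_assoc)
    qed simp
    finally show ?thesis by (simp add: sum_negf)
  qed
  \<comment> \<open>A trace in \<open>?L\<close> has no maximal letter at all, so \<open>?L\<close>
    contains only the empty trace; \<open>?R\<close> holds the pyramids of level one with their
    final \<open>a\<close> removed.\<close>
  let ?L = "{x \<in> over ?X. maxs x \<inter> ?X = {}}"
  let ?R = "{x \<in> over ?X. maxs x \<inter> indep a = {}}"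
  have "((\<lambda>w. \<Sum>c\<in>cliques I \<inter> Pow ?X. (- 1) ^ card c * F (w \<odot> ?ct c))
      has_sum (\<Sum>\<^sub>\<infinity>x\<in>?L. F x)) (over ?X)"
    by (rule moebius_inversion_over[OF _ F]) simp
  moreover have "((\<lambda>w. \<Sum>c\<in>cliques I \<inter> Pow (indep a). (- 1) ^ card c * F (w \<odot> ?ct c \<odot> letter a))
      has_sum (\<Sum>\<^sub>\<infinity>x\<in>?R. F (x \<odot> letter a))) (over ?X)"
    by (rule moebius_inversion_over[OF _ Fa]) auto
  ultimately have "(\<Sum>\<^sub>\<infinity>x\<in>?L. F x) = (\<Sum>\<^sub>\<infinity>x\<in>?R. F (x \<odot> letter a))"
    using balance overD(1)
      has_sum_cong[of "over ?X" "\<lambda>w. \<Sum>c\<in>cliques I \<inter> Pow ?X. (- 1) ^ card c * F (w \<odot> ?ct c)"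
        "\<lambda>w. \<Sum>c\<in>cliques I \<inter> Pow (indep a). (- 1) ^ card c * F (w \<odot> ?ct c \<odot> letter a)"]
    by (metis (no_types, lifting) has_sum_unique)
  moreover have "?L = {tr []}"
    using maxs_subset_letters maxs_eq_empty_iff by (auto simp: over_def)
  moreover have "F (tr []) = h u" using u by (simp add: F_def)
  ultimately have eq: "(\<Sum>\<^sub>\<infinity>x\<in>?R. F (x \<odot> letter a)) = h u" by simp
  have "(\<lambda>v. F (v \<odot> letter a)) summable_on ?R"
    by (rule summable_on_subset_banach[OF Fa]) auto
  then have "((\<lambda>v. F (v \<odot> letter a)) has_sum h u) ?R"
    unfolding eq[symmetric] by (rule has_sum_infsum)
  moreover have "inj_on (\<lambda>v. v \<odot> letter a) ?R"
    using tmult_right_cancel[of _ "letter a"] by (intro inj_onI) (blast dest: overD)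
  moreover have "pyramids a 1 = (\<lambda>v. v \<odot> letter a) ` ?R"
    unfolding pyramids_1_eq by (auto simp: over_def)
  ultimately show ?thesis
    unfolding F_def[symmetric] by (simp add: has_sum_reindex o_def)
qed

end

section \<open>The density of a bounded nonnegative harmonic function\<close>

lemma borel_measurable_nn_integral_count_space:
  fixes f :: "'i \<Rightarrow> 'b \<Rightarrow> ennreal"
  assumes "countable J" and [measurable]: "\<And>i. i \<in> J \<Longrightarrow> f i \<in> borel_measurable M"
  shows "(\<lambda>x. \<integral>\<^sup>+i. f i x \<partial>count_space J) \<in> borel_measurable M"
proof (cases "finite J")
  case True
  then show ?thesis by (simp add: nn_integral_count_space_finite)
next
  case False
  then have "J \<noteq> {}" by auto
  have "(\<integral>\<^sup>+i. f i x \<partial>count_space J) = (\<Sum>n. f (from_nat_into J n) x)" for x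
    by (simp add: nn_integral_bij_count_space[symmetric, OF bij_betw_from_nat_into[OF assms(1) False]]
        nn_integral_count_space_nat)
  then show ?thesis using \<open>J \<noteq> {}\<close> by (simp add: from_nat_into)
qed

text \<open>Bridge between the stopping identity, stated with \<open>has_sum\<close>, and measures
  of countable disjoint unions, which come as integrals over a counting measure.\<close>

lemma nn_integral_count_space_eq_iff_has_sum:
  fixes f :: "'b \<Rightarrow> real"
  assumes nonneg: "\<And>x. x \<in> A \<Longrightarrow> 0 \<le> f x" and "0 \<le> s"
  shows "(\<integral>\<^sup>+x. ennreal (f x) \<partial>count_space A) = ennreal s \<longleftrightarrow> (f has_sum s) A"
proof
  assume s: "(f has_sum s) A"
  then have "f summable_on A" by (auto simp: summable_on_def)
  then have "(\<lambda>x. norm (f x)) summable_on A"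
    using nonneg by (subst summable_on_cong[of _ _ f]) auto
  then have abs: "Infinite_Set_Sum.abs_summable_on f A" unfolding abs_summable_equivalent .
  show "(\<integral>\<^sup>+x. ennreal (f x) \<partial>count_space A) = ennreal s"
    using nn_integral_conv_infsetsum[OF abs nonneg] infsetsum_infsum[OF abs] infsumI[OF s] by simp
next
  assume s: "(\<integral>\<^sup>+x. ennreal (f x) \<partial>count_space A) = ennreal s"
  have "integrable (count_space A) f"
    by (rule integrableI_nonneg) (use s nonneg in \<open>auto simp: AE_count_space\<close>)
  then have abs: "Infinite_Set_Sum.abs_summable_on f A" by (simp add: abs_summable_on_def)
  then have "(\<lambda>x. norm (f x)) summable_on A" unfolding abs_summable_equivalent .
  then have "f summable_on A" by (rule abs_summable_summable)
  moreover have "infsum f A = s"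
    using nn_integral_conv_infsetsum[OF abs nonneg] infsetsum_infsum[OF abs] s assms(2)
      infsum_nonneg[of A f] nonneg by simp
  ultimately show "(f has_sum s) A" using has_sum_infsum by blast
qed

text \<open>The hypothesis says that \<open>X n - X k\<close> is orthogonal to \<open>X k\<close>. Hence
  \<open>\<parallel>X n - X k\<parallel>\<^sup>2 = q n - q k\<close> in \<open>L\<^sup>2\<close>, where \<open>q\<close> is bounded and
  increasing, and a fast subsequence converges almost everywhere.\<close>

lemma (in prob_space) bounded_orthogonal_increments_convergent:
  fixes X :: "nat \<Rightarrow> 'a \<Rightarrow> real"
  assumes X [measurable]: "\<And>n. X n \<in> borel_measurable M"
    and bnd: "\<And>n x. 0 \<le> X n x" "\<And>n x. X n x \<le> K"
    and orth: "\<And>k n. k \<le> n \<Longrightarrow> (LINT x|M. X n x * X k x) = q k"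
  shows "\<exists>\<phi> r. \<phi> \<in> borel_measurable M \<and> (\<forall>x. 0 \<le> \<phi> x) \<and> (\<forall>x. \<phi> x \<le> K) \<and>
    strict_mono r \<and> (AE x in M. (\<lambda>j. X (r j) x) \<longlonglongrightarrow> \<phi> x)"
proof -
  have K: "0 \<le> K" using bnd by (meson order_trans)
  have int: "integrable M (\<lambda>x. X n x * X k x)" for n k
  proof (rule integrable_const_bound[where B = "K * K"])
    show "AE x in M. norm (X n x * X k x) \<le> K * K"
      using bnd K by (intro AE_I2) (auto simp: abs_mult intro!: mult_mono)
  qed simp
  have sq: "(LINT x|M. (X n x - X k x)\<^sup>2) = q n - q k" if "k \<le> n" for k n
  proof -
    have "(LINT x|M. (X n x - X k x)\<^sup>2)
        = (LINT x|M. (X n x * X n x - 2 * (X n x * X k x)) + X k x * X k x)"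
      by (intro Bochner_Integration.integral_cong) (auto simp: power2_eq_square algebra_simps)
    also have "\<dots> = q n - 2 * q k + q k"
      using int orth that by simp
    finally show ?thesis by simp
  qed
  have sq_int: "integrable M (\<lambda>x. (X n x - X k x)\<^sup>2)" for n k
  proof -
    have "integrable M (\<lambda>x. (X n x * X n x - 2 * (X n x * X k x)) + X k x * X k x)"
      using int by auto
    then show ?thesis
      by (rule Bochner_Integration.integrable_cong[THEN iffD1, rotated -1])
        (auto simp: power2_eq_square algebra_simps)
  qed
  have inc: "incseq q"
  proof (rule incseq_SucI)
    fix n
    have "0 \<le> (LINT x|M. (X (Suc n) x - X n x)\<^sup>2)" by (intro integral_nonneg_AE) auto
    then show "q n \<le> q (Suc n)" using sq[of n "Suc n"] by simp
  qed
  have q_le: "q n \<le> K * K" for n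
  proof -
    have "q n = (LINT x|M. X n x * X n x)" using orth[of n n] by simp
    also have "\<dots> \<le> (LINT x|M. K * K)"
      using int bnd K by (intro integral_mono) (auto intro!: mult_mono)
    finally show ?thesis by (simp add: prob_space)
  qed
  obtain L where L: "q \<longlonglongrightarrow> L" "\<And>n. q n \<le> L"
    using incseq_convergent[OF inc, of "K * K"] q_le by auto
  have ev: "\<exists>N. \<forall>n\<ge>N. L - q n \<le> (1 / 4) ^ j" for j :: nat
  proof -
    have "eventually (\<lambda>n. dist (q n) L < (1 / 4) ^ j) sequentially"
      using L(1) by (rule tendstoD) simp
    then obtain N where N: "\<forall>n\<ge>N. dist (q n) L < (1 / 4) ^ j"
      by (auto simp: eventually_sequentially)
    have "L - q n \<le> (1 / 4) ^ j" if "n \<ge> N" for n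
      using N[rule_format, OF that] abs_ge_minus_self[of "q n - L"] by (simp add: dist_real_def)
    then show ?thesis by blast
  qed
  have "\<exists>r. \<forall>j. L - q (r j) \<le> (1 / 4) ^ j \<and> r j < r (Suc j)"
  proof (rule dependent_nat_choice)
    show "\<exists>n. L - q n \<le> (1 / 4) ^ 0" using ev[of 0] by blast
    show "\<exists>m. L - q m \<le> (1 / 4) ^ Suc j \<and> n < m" for n j
    proof -
      obtain N where "\<forall>m\<ge>N. L - q m \<le> (1 / 4) ^ Suc j" using ev by blast
      then show ?thesis by (intro exI[of _ "max N (Suc n)"]) auto
    qed
  qed
  then obtain r where r: "\<And>j. L - q (r j) \<le> (1 / 4) ^ j" "strict_mono r"
    by (auto simp: strict_mono_Suc_iff)
  define D where "D j x = \<bar>X (r (Suc j)) x - X (r j) x\<bar>" for j x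
  have D_meas [measurable]: "D j \<in> borel_measurable M" for j unfolding D_def by measurable
  have D_le: "(\<integral>\<^sup>+x. ennreal (D j x) \<partial>M) \<le> ennreal ((1 / 2) ^ j)" for j
  proof -
    \<comment> \<open>Obtained by expanding \<open>(2 ^ j * d - 1)\<^sup>2 \<ge> 0\<close>. It
      converts the second moment bound \<open>(1 / 4) ^ j\<close> into the summable first moment
      bound \<open>(1 / 2) ^ j\<close>.\<close>
    let ?Y = "\<lambda>x. 2 ^ j / 2 * (X (r (Suc j)) x - X (r j) x)\<^sup>2 + (1 / 2) ^ j / 2"
    have le: "D j x \<le> ?Y x" for x
    proof -
      define d where "d = \<bar>X (r (Suc j)) x - X (r j) x\<bar>"
      have "0 \<le> (1 / 2) ^ j / 2 * (2 ^ j * d - 1)\<^sup>2" by simp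
      also have "\<dots> = 2 ^ j / 2 * d\<^sup>2 + (1 / 2) ^ j / 2 - d"
        by (simp add: power2_eq_square power_divide field_simps)
      finally show ?thesis by (simp add: D_def d_def)
    qed
    have "(\<integral>\<^sup>+x. ennreal (D j x) \<partial>M) \<le> (\<integral>\<^sup>+x. ennreal (?Y x) \<partial>M)"
      by (intro nn_integral_mono ennreal_leI le)
    also have "\<dots> = ennreal (LINT x|M. ?Y x)"
      using sq_int by (intro nn_integral_eq_integral) auto
    also have "(LINT x|M. ?Y x) = 2 ^ j / 2 * (q (r (Suc j)) - q (r j)) + (1 / 2) ^ j / 2"
      using sq_int sq[of "r j" "r (Suc j)"] r(2)
      by (simp add: prob_space strict_mono_less_eq del: power_Suc)
    also have "\<dots> \<le> 2 ^ j / 2 * (1 / 4) ^ j + (1 / 2) ^ j / 2"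
      using r(1)[of j] L(2)[of "r (Suc j)"] by (intro add_mono mult_left_mono) auto
    also have "\<dots> = (1 / 2) ^ j"
    proof -
      have "(2::real) ^ j * (1 / 4) ^ j = (1 / 2) ^ j"
        by (simp flip: power_mult_distrib)
      then show ?thesis by simp
    qed
    finally show ?thesis by (simp add: ennreal_leI)
  qed
  have "(\<integral>\<^sup>+x. (\<Sum>j. ennreal (D j x)) \<partial>M) = (\<Sum>j. \<integral>\<^sup>+x. ennreal (D j x) \<partial>M)"
    by (intro nn_integral_suminf) simp
  also have "\<dots> \<le> (\<Sum>j. ennreal ((1 / 2) ^ j))" by (intro suminf_le D_le) auto
  also have "\<dots> = ennreal (\<Sum>j. (1 / 2) ^ j)"
    by (intro suminf_ennreal2) (auto intro: summable_geometric)
  finally have "(\<integral>\<^sup>+x. (\<Sum>j. ennreal (D j x)) \<partial>M) \<noteq> \<infinity>"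
    by (auto simp: top_unique)
  then have "AE x in M. (\<Sum>j. ennreal (D j x)) \<noteq> \<infinity>"
    by (intro nn_integral_noteq_infinite) auto
  then have conv: "AE x in M. convergent (\<lambda>j. X (r j) x)"
  proof eventually_elim
    case (elim x)
    then have "summable (\<lambda>j. D j x)"
      by (intro summable_suminf_not_top) (auto simp: D_def)
    then have "summable (\<lambda>j. X (r (Suc j)) x - X (r j) x)"
      unfolding D_def by (rule summable_rabs_cancel)
    then have "convergent (\<lambda>n. \<Sum>j<n. X (r (Suc j)) x - X (r j) x)"
      by (simp add: summable_iff_convergent)
    then have "convergent (\<lambda>n. X (r n) x - X (r 0) x)"
      by (simp add: sum_lessThan_telescope[of "\<lambda>j. X (r j) x"])
    then have "convergent (\<lambda>n. (X (r n) x - X (r 0) x) + X (r 0) x)"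
      by (intro convergent_add convergent_const)
    then show ?case by simp
  qed
  \<comment> \<open>\<open>lim\<close> is unspecified where the sequence diverges; clamping makes
    the bounds hold at every point.\<close>
  define \<phi> where "\<phi> x = max 0 (min K (lim (\<lambda>j. X (r j) x)))" for x
  show ?thesis
  proof (intro exI[of _ \<phi>] exI[of _ r] conjI allI)
    show "\<phi> \<in> borel_measurable M" unfolding \<phi>_def by measurable
    show "0 \<le> \<phi> x" "\<phi> x \<le> K" for x using K by (auto simp: \<phi>_def)
    show "strict_mono r" by fact
    show "AE x in M. (\<lambda>j. X (r j) x) \<longlonglongrightarrow> \<phi> x"
      using conv
    proof eventually_elim
      case (elim x)
      then have l: "(\<lambda>j. X (r j) x) \<longlonglongrightarrow> lim (\<lambda>j. X (r j) x)"
        by (simp add: convergent_LIMSEQ_iff)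
      then have "0 \<le> lim (\<lambda>j. X (r j) x)" "lim (\<lambda>j. X (r j) x) \<le> K"
        using bnd by (auto intro: LIMSEQ_le_const LIMSEQ_le_const2)
      then show ?case using l by (simp add: \<phi>_def)
    qed
  qed
qed

section \<open>The martingale of a harmonic function along pyramids\<close>

context bernoulli
begin

lemma countable_pyramids [simp, intro]: "countable (pyramids a n)"
  by (rule countable_subset[OF _ countable_traces]) (auto simp: pyramids_def)

lemma weight_stopping:
  assumes "u \<in> traces" shows "((\<lambda>v. weight (u \<odot> v)) has_sum weight u) (pyramids a 1)"
proof -
  have "((\<lambda>v. weight v * 1) has_sum 1) (pyramids a 1)"
    using harmonic_stopping[OF moebius_harmonic_const[of 1] _ assms, of 1 a] by simp
  then have "((\<lambda>v. weight u * (weight v * 1)) has_sum weight u * 1) (pyramids a 1)"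
    by (rule has_sum_cmult_right)
  then have "((\<lambda>v. weight (u \<odot> v)) has_sum weight u * 1) (pyramids a 1)"
    by (rule has_sum_cong[THEN iffD1, rotated])
      (use assms pyramids_traces in \<open>auto simp: weight_tmult\<close>)
  then show ?thesis by simp
qed

text \<open>The disjoint cylinders on the right lie in \<open>cyl u\<close> and their weights add up
  to \<open>weight u\<close>. So almost every continuation of \<open>u\<close> contains a further
  \<open>a\<close>.\<close>

lemma AE_cylinder_pyramids:
  assumes u: "u \<in> traces"
  shows "AE x in P. x \<in> cyl u \<longleftrightarrow> x \<in> (\<Union>v\<in>pyramids a 1. cyl (u \<odot> v))"
proof -
  let ?U = "\<Union>v\<in>pyramids a 1. cyl (u \<odot> v)"
  have sets: "cyl (u \<odot> v) \<in> sets P" if "v \<in> pyramids a 1" for v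
    using that u pyramids_traces by auto
  have U: "?U \<in> sets P" using sets by (intro sets.countable_UN') auto
  have sub: "?U \<subseteq> cyl u" using u cylinder_tmult_subset pyramids_traces by blast
  have "emeasure P ?U = (\<integral>\<^sup>+v. ennreal (weight (u \<odot> v)) \<partial>count_space (pyramids a 1))"
    using sets cylinder_pyramids_disjoint[OF u, of a 1]
    by (subst emeasure_UN_countable) (auto simp: emeasure_cyl)
  also have "\<dots> = ennreal (weight u)"
    by (subst nn_integral_count_space_eq_iff_has_sum) (use weight_stopping[OF u, of a] in auto)
  finally have "emeasure P (cyl u - ?U) = 0"
    using U sub u by (subst emeasure_Diff) (auto simp: emeasure_cyl)
  then have "cyl u - ?U \<in> null_sets P" using U u by (intro null_setsI) auto
  from AE_not_in[OF this] show ?thesis by (rule eventually_mono) (use sub in blast)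
qed

lemma nn_integral_cylinder_pyramids:
  assumes u: "u \<in> traces" and [measurable]: "g \<in> borel_measurable P"
  shows "(\<integral>\<^sup>+x. g x * indicator (cyl u) x \<partial>P)
    = (\<integral>\<^sup>+v. (\<integral>\<^sup>+x. g x * indicator (cyl (u \<odot> v)) x \<partial>P) \<partial>count_space (pyramids a 1))"
proof -
  let ?U = "\<Union>v\<in>pyramids a 1. cyl (u \<odot> v)"
  have sets: "cyl (u \<odot> v) \<in> sets P" if "v \<in> pyramids a 1" for v
    using that u pyramids_traces by auto
  have U: "?U \<in> sets P" using sets by (intro sets.countable_UN') auto
  have "(\<integral>\<^sup>+x. g x * indicator (cyl u) x \<partial>P) = (\<integral>\<^sup>+x. g x * indicator ?U x \<partial>P)"
    using AE_cylinder_pyramids[OF u, of a]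
    by (intro nn_integral_cong_AE) (auto elim!: eventually_mono simp: indicator_def)
  also have "\<dots> = emeasure (density P g) ?U" using U by (simp add: emeasure_density)
  also have "\<dots> = (\<integral>\<^sup>+v. emeasure (density P g) (cyl (u \<odot> v)) \<partial>count_space (pyramids a 1))"
    using sets cylinder_pyramids_disjoint[OF u, of a 1] by (intro emeasure_UN_countable) auto
  also have "\<dots> = (\<integral>\<^sup>+v. (\<integral>\<^sup>+x. g x * indicator (cyl (u \<odot> v)) x \<partial>P) \<partial>count_space (pyramids a 1))"
    using sets by (intro nn_integral_cong) (simp add: emeasure_density)
  finally show ?thesis .
qed

text \<open>The random variable \<open>h (V n x)\<close>: the cylinders are disjoint, so at most one
  summand is nonzero, and the value is 0 where \<open>x\<close> has no prefix in
  \<open>pyramids a n\<close>. As a counting integral it is open to Tonelli.\<close>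

definition approx :: "('a list set \<Rightarrow> real) \<Rightarrow> 'a \<Rightarrow> nat \<Rightarrow> 'a gen_trace \<Rightarrow> ennreal" where
  "approx h a n x = (\<integral>\<^sup>+v. ennreal (h v) * indicator (cyl v) x \<partial>count_space (pyramids a n))"

lemma cyl_pyramids_eq:
  assumes "u \<in> pyramids a n" "v \<in> pyramids a n" "x \<in> cyl u" "x \<in> cyl v"
  shows "u = v"
  using cylinder_pyramids_disjoint[of "tr []" a n] assms pyramids_traces
  by (fastforce simp: disjoint_family_on_def)

lemma approx_measurable [measurable]: "approx h a n \<in> borel_measurable P"
  unfolding approx_def
  by (rule borel_measurable_nn_integral_count_space)
    (auto intro!: borel_measurable_times_ennreal borel_measurable_indicator cyl_sets
      intro: pyramids_traces)

lemma approx_on_cyl: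
  assumes "u \<in> pyramids a n" "x \<in> cyl u" shows "approx h a n x = ennreal (h u)"
proof -
  have "approx h a n x = (\<Sum>v\<in>{u}. ennreal (h v) * indicator (cyl v) x)"
    unfolding approx_def
  proof (rule nn_integral_count_space')
    show "ennreal (h v) * indicator (cyl v) x = 0" if "v \<in> pyramids a n" "v \<notin> {u}" for v
      using cyl_pyramids_eq[OF that(1) assms(1) _ assms(2)] that by (auto simp: indicator_def)
  qed (use assms in auto)
  then show ?thesis using assms by simp
qed

lemma approx_le:
  assumes "\<And>u. u \<in> traces \<Longrightarrow> h u \<le> K"
  shows "approx h a n x \<le> ennreal K"
proof (cases "\<exists>u\<in>pyramids a n. x \<in> cyl u")
  case True
  then show ?thesis using approx_on_cyl assms pyramids_traces by (auto intro!: ennreal_leI)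
next
  case False
  then have "approx h a n x = (\<Sum>v\<in>{}. ennreal (h v) * indicator (cyl v) x)"
    unfolding approx_def by (intro nn_integral_count_space') auto
  then show ?thesis by simp
qed

text \<open>The martingale property. Splitting \<open>cyl u\<close> along the next occurrence of
  \<open>a\<close> raises the level by one, and the stopping identity at \<open>u\<close> collects
  the pieces.\<close>

lemma nn_integral_approx_cyl:
  assumes harm: "moebius_harmonic I P h"
    and bnd: "\<And>u. u \<in> traces \<Longrightarrow> 0 \<le> h u" "\<And>u. u \<in> traces \<Longrightarrow> h u \<le> K"
    and u: "u \<in> pyramids a k"
  shows "(\<integral>\<^sup>+x. approx h a (k + j) x * indicator (cyl u) x \<partial>P) = ennreal (weight u * h u)"
  using u
proof (induction j arbitrary: u k)
  case 0
  then have tr: "u \<in> traces" by (rule pyramids_traces)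
  have "(\<integral>\<^sup>+x. approx h a (k + 0) x * indicator (cyl u) x \<partial>P)
      = (\<integral>\<^sup>+x. ennreal (h u) * indicator (cyl u) x \<partial>P)"
    using approx_on_cyl[OF 0] by (intro nn_integral_cong) (auto simp: indicator_def)
  also have "\<dots> = ennreal (h u) * ennreal (weight u)"
    using tr by (simp add: nn_integral_cmult_indicator emeasure_cyl)
  finally show ?case using bnd tr by (simp add: ennreal_mult[symmetric] mult.commute)
next
  case (Suc j)
  then have tr: "u \<in> traces" by (blast intro: pyramids_traces)
  have "(\<integral>\<^sup>+x. approx h a (k + Suc j) x * indicator (cyl u) x \<partial>P)
      = (\<integral>\<^sup>+v. (\<integral>\<^sup>+x. approx h a (k + Suc j) x * indicator (cyl (u \<odot> v)) x \<partial>P)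
          \<partial>count_space (pyramids a 1))"
    by (rule nn_integral_cylinder_pyramids[OF tr]) simp
  also have "\<dots> = (\<integral>\<^sup>+v. ennreal (weight u * (weight v * h (u \<odot> v))) \<partial>count_space (pyramids a 1))"
  proof (rule nn_integral_cong)
    fix v assume "v \<in> space (count_space (pyramids a 1))"
    then have v: "v \<in> pyramids a 1" by simp
    then have "u \<odot> v \<in> pyramids a (Suc k)" using pyramids_tmult[OF Suc.prems v] by simp
    from Suc.IH[OF this]
    show "(\<integral>\<^sup>+x. approx h a (k + Suc j) x * indicator (cyl (u \<odot> v)) x \<partial>P)
        = ennreal (weight u * (weight v * h (u \<odot> v)))"
      using pyramids_traces[OF v] tr by (simp add: weight_tmult mult.assoc)
  qed
  also have "\<dots> = ennreal (weight u * h u)"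
  proof (subst nn_integral_count_space_eq_iff_has_sum)
    show "((\<lambda>v. weight u * (weight v * h (u \<odot> v))) has_sum weight u * h u) (pyramids a 1)"
      by (intro has_sum_cmult_right harmonic_stopping[OF harm _ tr, of K])
        (use bnd in \<open>simp add: abs_of_nonneg\<close>)
  qed (use bnd tr pyramids_traces in auto)
  finally show ?case .
qed

text \<open>\<open>approx h a k\<close> is constant on each cylinder of level \<open>k\<close>, and
  there the martingale property evaluates the other factor. That the result does not mention
  \<open>n\<close> is the orthogonality used for convergence.\<close>

lemma nn_integral_approx_mult:
  assumes harm: "moebius_harmonic I P h"
    and bnd: "\<And>u. u \<in> traces \<Longrightarrow> 0 \<le> h u" "\<And>u. u \<in> traces \<Longrightarrow> h u \<le> K"
    and "k \<le> n"
  shows "(\<integral>\<^sup>+x. approx h a n x * approx h a k x \<partial>P)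
    = (\<integral>\<^sup>+v. ennreal (h v) * ennreal (weight v * h v) \<partial>count_space (pyramids a k))"
proof -
  obtain j where n: "n = k + j" using \<open>k \<le> n\<close> le_Suc_ex by blast
  have "(\<integral>\<^sup>+x. approx h a n x * approx h a k x \<partial>P)
      = (\<integral>\<^sup>+x. \<integral>\<^sup>+v. ennreal (h v) * (approx h a n x * indicator (cyl v) x)
          \<partial>count_space (pyramids a k) \<partial>P)"
    by (subst (2) approx_def, subst nn_integral_cmult[symmetric]) (auto simp: mult_ac)
  also have "\<dots> = (\<integral>\<^sup>+v. \<integral>\<^sup>+x. ennreal (h v) * (approx h a n x * indicator (cyl v) x)
      \<partial>P \<partial>count_space (pyramids a k))"
    by (rule nn_integral_count_space_nn_integral)
      (auto intro!: borel_measurable_times_ennreal borel_measurable_indicator cyl_sets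
        intro: pyramids_traces)
  also have "\<dots> = (\<integral>\<^sup>+v. ennreal (h v) * ennreal (weight v * h v) \<partial>count_space (pyramids a k))"
  proof (rule nn_integral_cong)
    fix v assume "v \<in> space (count_space (pyramids a k))"
    then have v: "v \<in> pyramids a k" by simp
    then show "(\<integral>\<^sup>+x. ennreal (h v) * (approx h a n x * indicator (cyl v) x) \<partial>P)
        = ennreal (h v) * ennreal (weight v * h v)"
      using nn_integral_approx_cyl[OF harm bnd v, of j] pyramids_traces[OF v]
      by (subst nn_integral_cmult)
        (auto simp: n intro!: borel_measurable_times_ennreal borel_measurable_indicator cyl_sets)
  qed
  finally show ?thesis .
qed

lemma exists_density_on_pyramids:
  assumes harm: "moebius_harmonic I P h"
    and bnd: "\<And>u. u \<in> traces \<Longrightarrow> 0 \<le> h u" "\<And>u. u \<in> traces \<Longrightarrow> h u \<le> K"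
  obtains \<phi> where "\<phi> \<in> borel_measurable P" "\<And>x. 0 \<le> \<phi> x" "\<And>x. \<phi> x \<le> K"
    "\<And>k u. u \<in> pyramids a k \<Longrightarrow> (LINT x:cyl u|P. \<phi> x) = weight u * h u"
proof -
  have K: "0 \<le> K" using bnd[of "tr []"] by simp
  define X where "X n x = enn2real (approx h a n x)" for n x
  have fin: "approx h a n x < \<infinity>" for n x
    using le_less_trans[OF approx_le[OF bnd(2)] ennreal_less_top] by simp
  have ennX: "ennreal (X n x) = approx h a n x" for n x
    using fin[of n x] by (simp add: X_def)
  have X_meas [measurable]: "X n \<in> borel_measurable P" for n
    unfolding X_def by measurable
  have X_nonneg: "0 \<le> X n x" for n x by (simp add: X_def)
  have X_le: "X n x \<le> K" for n x
    using approx_le[of h K a n x, OF bnd(2)] K by (simp add: ennX[symmetric] X_nonneg)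
  define q where "q k = enn2real (\<integral>\<^sup>+v. ennreal (h v) * ennreal (weight v * h v)
      \<partial>count_space (pyramids a k))" for k
  have "(LINT x|P. X n x * X k x) = q k" if "k \<le> n" for k n
    using nn_integral_approx_mult[OF harm bnd that, of a] X_nonneg
    by (subst integral_eq_nn_integral) (auto simp: ennreal_mult ennX q_def)
  from bounded_orthogonal_increments_convergent[of X K q, OF X_meas X_nonneg X_le this]
  obtain \<phi> r where \<phi>: "\<phi> \<in> borel_measurable P" "\<And>x. 0 \<le> \<phi> x" "\<And>x. \<phi> x \<le> K"
    and r: "strict_mono r" "AE x in P. (\<lambda>j. X (r j) x) \<longlonglongrightarrow> \<phi> x"
    by blast
  note \<phi>(1) [measurable]
  have "(LINT x:cyl u|P. \<phi> x) = weight u * h u" if u: "u \<in> pyramids a k" for u k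
  proof -
    have tr: "u \<in> traces" using u by (rule pyramids_traces)
    then have [measurable]: "cyl u \<in> sets P" by simp
    have "(\<lambda>j. LINT x|P. X (r j) x * indicator (cyl u) x)
        \<longlonglongrightarrow> (LINT x|P. \<phi> x * indicator (cyl u) x)"
    proof (rule integral_dominated_convergence[where w = "\<lambda>x. K"])
      show "AE x in P. (\<lambda>j. X (r j) x * indicator (cyl u) x) \<longlonglongrightarrow> \<phi> x * indicator (cyl u) x"
        using r(2) by eventually_elim (auto intro: tendsto_intros)
      show "AE x in P. norm (X (r j) x * indicator (cyl u) x) \<le> K" for j
        using X_le X_nonneg K by (intro AE_I2) (auto simp: indicator_def)
    qed (use tr in auto)
    \<comment> \<open>Since \<open>r j\<close> is at least \<open>j\<close>, the level of
      \<open>u\<close> is reached from \<open>k\<close> on, and the martingale property makes the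
      sequence of integrals constant.\<close>
    moreover have "(LINT x|P. X (r j) x * indicator (cyl u) x) = weight u * h u" if "j \<ge> k" for j
    proof -
      have "k \<le> r j" using seq_suble[OF r(1), of j] that by linarith
      then obtain i where i: "r j = k + i" using le_Suc_ex by blast
      have "(LINT x|P. X (r j) x * indicator (cyl u) x)
          = enn2real (\<integral>\<^sup>+x. approx h a (r j) x * indicator (cyl u) x \<partial>P)"
        using X_nonneg tr
        by (subst integral_eq_nn_integral) (auto simp: ennreal_mult' ennX ennreal_indicator)
      also have "\<dots> = weight u * h u"
        using nn_integral_approx_cyl[OF harm bnd u, of i] bnd(1)[OF tr] by (simp add: i)
      finally show ?thesis .
    qed
    then have "(\<lambda>j. LINT x|P. X (r j) x * indicator (cyl u) x) \<longlonglongrightarrow> weight u * h u"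
      by (intro tendsto_eventually) (auto simp: eventually_sequentially)
    ultimately have "(LINT x|P. \<phi> x * indicator (cyl u) x) = weight u * h u"
      by (rule LIMSEQ_unique)
    then show ?thesis by (simp add: set_lebesgue_integral_def mult.commute)
  qed
  then show thesis using that \<phi> by blast
qed

section \<open>Passage from pyramids to all traces\<close>

abbreviation tprod :: "'a list set list \<Rightarrow> 'a list set" where
  "tprod vs \<equiv> foldr (\<odot>) vs (tr [])"

lemma tprod_pyramids:
  assumes "set vs \<subseteq> pyramids a 1"
  shows "tprod vs \<in> pyramids a (length vs)" "letters (tprod vs) = (\<Union>v\<in>set vs. letters v)"
proof -
  have "tprod vs \<in> pyramids a (length vs) \<and> letters (tprod vs) = (\<Union>v\<in>set vs. letters v)"
    using assms
  proof (induction vs)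
    case Nil
    then show ?case by (simp add: pyramids_0)
  next
    case (Cons v vs)
    then have v: "v \<in> pyramids a 1" "v \<in> traces" "tprod vs \<in> traces"
      using pyramids_traces by auto
    have "v \<odot> tprod vs \<in> pyramids a (1 + length vs)"
    proof (cases vs)
      case Nil
      then show ?thesis using v by simp
    qed (use Cons v pyramids_tmult[of v a 1 "tprod vs" "length vs"] in auto)
    then show ?case using Cons v by simp
  qed
  then show "tprod vs \<in> pyramids a (length vs)" "letters (tprod vs) = (\<Union>v\<in>set vs. letters v)"
    by auto
qed

text \<open>If \<open>\<bar>d\<bar> \<le> s * weight\<close> and \<open>d\<close> vanishes on pyramids, then following a product \<open>p\<close>
  of pyramids containing all letters improves the bound to \<open>s * (1 - weight p) * weight\<close>.\<close>

lemma additive_eq_0_if_0_on_pyramids: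
  fixes d :: "'a list set \<Rightarrow> real"
  assumes add: "\<And>u. u \<in> traces \<Longrightarrow> ((\<lambda>v. d (u \<odot> v)) has_sum d u) (pyramids a 1)"
    and bnd: "\<And>u. u \<in> traces \<Longrightarrow> \<bar>d u\<bar> \<le> K * weight u"
    and zero: "\<And>n u. u \<in> pyramids a n \<Longrightarrow> d u = 0"
    and u: "u \<in> traces"
  shows "d u = 0"
proof -
  obtain vs where vs: "set vs \<subseteq> pyramids a 1" "(\<Union>v\<in>set vs. letters v) = UNIV"
    using irreducible by (auto simp: irreducible_trace_monoid_def intro: full_pyramid_list[of a])
  define \<delta> where "\<delta> = weight (tprod vs)"
  have p: "tprod vs \<in> pyramids a (length vs)" "letters (tprod vs) = UNIV"
    using tprod_pyramids[OF vs(1)] vs(2) by auto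
  \<comment> \<open>Single out the summand \<open>v\<close> of the additivity relation; the others
    are bounded by \<open>s\<close> times their weights, which total
    \<open>weight u - weight (u \<odot> v)\<close>.\<close>
  have step: "\<bar>d u\<bar> \<le> s * (weight u - weight (u \<odot> v)) + \<bar>d (u \<odot> v)\<bar>"
    if s: "\<And>u. u \<in> traces \<Longrightarrow> \<bar>d u\<bar> \<le> s * weight u" and u: "u \<in> traces" and v: "v \<in> pyramids a 1"
    for s u v
  proof -
    have rest: "(f has_sum t - f v) (pyramids a 1 - {v})" if "(f has_sum t) (pyramids a 1)"
      for f :: "'a list set \<Rightarrow> real" and t
      using has_sum_Diff[OF that, of "{v}" "f v"] v has_sum_finite[of "{v}" f] by simp
    have d: "((\<lambda>v. d (u \<odot> v)) has_sum d u - d (u \<odot> v)) (pyramids a 1 - {v})"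
      by (rule rest[OF add[OF u]])
    have w: "((\<lambda>v. s * weight (u \<odot> v)) has_sum s * (weight u - weight (u \<odot> v))) (pyramids a 1 - {v})"
      by (intro has_sum_cmult_right rest weight_stopping u)
    have le: "\<bar>d (u \<odot> w)\<bar> \<le> s * weight (u \<odot> w)" if "w \<in> pyramids a 1 - {v}" for w
      using s u that pyramids_traces by auto
    have "d u - d (u \<odot> v) \<le> s * (weight u - weight (u \<odot> v))"
      by (rule has_sum_mono[OF d w]) (use le in force)
    moreover have "- (d u - d (u \<odot> v)) \<le> s * (weight u - weight (u \<odot> v))"
      by (rule has_sum_mono[OF has_sum_uminusI[OF d] w]) (use le in force)
    ultimately show ?thesis by linarith
  qed
  have steps: "\<bar>d u\<bar> \<le> s * (weight u - weight (u \<odot> tprod ws)) + \<bar>d (u \<odot> tprod ws)\<bar>"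
    if s: "\<And>u. u \<in> traces \<Longrightarrow> \<bar>d u\<bar> \<le> s * weight u" and "u \<in> traces" and "set ws \<subseteq> pyramids a 1"
    for s u ws
    using that(2,3)
  proof (induction ws arbitrary: u)
    case (Cons w ws)
    have w: "w \<in> pyramids a 1" "w \<in> traces" "tprod ws \<in> traces"
      using Cons.prems tprod_pyramids(1)[of ws a] pyramids_traces by auto
    have "\<bar>d (u \<odot> w)\<bar> \<le> s * (weight (u \<odot> w) - weight (u \<odot> w \<odot> tprod ws)) + \<bar>d (u \<odot> w \<odot> tprod ws)\<bar>"
      using Cons w by (intro Cons.IH) auto
    then show ?case
      using step[OF s Cons.prems(1) w(1)] Cons.prems(1) w by (simp add: tmult_assoc algebra_simps)
  qed simp
  \<comment> \<open>The last term of \<open>steps\<close> vanishes because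
    \<open>u \<odot> tprod vs\<close> is a pyramid. The new bound again holds at all traces, so it
    can replace \<open>s\<close>.\<close>
  have contract: "\<bar>d u\<bar> \<le> s * (1 - \<delta>) * weight u"
    if s: "\<And>u. u \<in> traces \<Longrightarrow> \<bar>d u\<bar> \<le> s * weight u" and u: "u \<in> traces" for s u
  proof -
    have "d (u \<odot> tprod vs) = 0" by (rule zero[OF tmult_full_pyramid[OF u p]])
    then show ?thesis
      using steps[OF s u vs(1)] u p pyramids_traces
      by (simp add: weight_tmult \<delta>_def algebra_simps)
  qed
  have pow: "\<bar>d u\<bar> \<le> K * (1 - \<delta>) ^ n * weight u" if "u \<in> traces" for n u
    using that
  proof (induction n arbitrary: u)
    case (Suc n)
    then show ?case using contract[of "K * (1 - \<delta>) ^ n" u] by (simp add: mult_ac)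
  qed (simp add: bnd)
  have "0 < \<delta>" "\<delta> \<le> 1"
    using weight_pos p pyramids_traces by (auto simp: \<delta>_def weight_def)
  then have "(\<lambda>n. K * (1 - \<delta>) ^ n * weight u) \<longlonglongrightarrow> K * 0 * weight u"
    by (intro tendsto_intros LIMSEQ_realpow_zero) auto
  then have "\<bar>d u\<bar> \<le> 0" using pow[OF u] by (intro LIMSEQ_le_const) auto
  then show ?thesis by simp
qed

theorem exists_density:
  assumes harm: "moebius_harmonic I P h"
    and bnd: "\<And>u. u \<in> traces \<Longrightarrow> 0 \<le> h u" "\<And>u. u \<in> traces \<Longrightarrow> h u \<le> K"
  obtains \<phi> where "\<phi> \<in> borel_measurable P" "\<And>x. 0 \<le> \<phi> x" "\<And>x. \<phi> x \<le> K"
    "\<And>u. u \<in> traces \<Longrightarrow> (LINT x:cyl u|P. \<phi> x) = weight u * h u"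
proof -
  fix a :: 'a
  obtain \<phi> where \<phi>: "\<phi> \<in> borel_measurable P" "\<And>x. 0 \<le> \<phi> x" "\<And>x. \<phi> x \<le> K"
    "\<And>k u. u \<in> pyramids a k \<Longrightarrow> (LINT x:cyl u|P. \<phi> x) = weight u * h u"
    using exists_density_on_pyramids[OF harm bnd, of a] by blast
  note \<phi>(1) [measurable]
  define m where "m u = (LINT x:cyl u|P. \<phi> x)" for u
  have nn: "(\<integral>\<^sup>+x. ennreal (\<phi> x) * indicator (cyl u) x \<partial>P) = ennreal (m u)"
    and m_le: "m u \<le> K * weight u" and m_nonneg: "0 \<le> m u" if u: "u \<in> traces" for u
  proof -
    have int: "integrable P (\<lambda>x. indicator (cyl u) x * \<phi> x)"
    proof (rule integrable_const_bound[where B = K])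
      show "AE x in P. norm (indicator (cyl u) x * \<phi> x) \<le> K"
        using \<phi>(2,3) order_trans[OF \<phi>(2,3)] by (auto simp: indicator_def)
    qed (use u \<phi>(1) in \<open>auto intro!: borel_measurable_times borel_measurable_indicator\<close>)
    show "0 \<le> m u"
      unfolding m_def set_lebesgue_integral_def using \<phi>(2) by (intro integral_nonneg_AE) auto
    have "(\<integral>\<^sup>+x. ennreal (\<phi> x) * indicator (cyl u) x \<partial>P)
        = (\<integral>\<^sup>+x. ennreal (indicator (cyl u) x * \<phi> x) \<partial>P)"
      by (intro nn_integral_cong) (auto simp: indicator_def)
    also have "\<dots> = ennreal (m u)"
      unfolding m_def set_lebesgue_integral_def
      using int \<phi>(2) by (subst nn_integral_eq_integral) auto
    finally show "(\<integral>\<^sup>+x. ennreal (\<phi> x) * indicator (cyl u) x \<partial>P) = ennreal (m u)" .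
    have "m u \<le> (LINT x|P. indicator (cyl u) x * K)"
      unfolding m_def set_lebesgue_integral_def real_scaleR_def
      by (rule integral_mono[OF int]) (use u \<phi>(3) in \<open>auto intro!: mult_left_mono integrable_real_indicator
        simp: emeasure_cyl\<close>)
    then show "m u \<le> K * weight u"
      using u cylinder_subset_boundary[of u]
      by (simp add: weight_def Int_absorb2 space_P mult.commute)
  qed
  \<comment> \<open>Both terms are additive over the next pyramids, the integral by the partition up
    to a null set and the other by the stopping identity. Both lie between 0 and
    \<open>K * weight u\<close>, which bounds their difference.\<close>
  have "m u - weight u * h u = 0" if "u \<in> traces" for u
  proof (rule additive_eq_0_if_0_on_pyramids[where a = a and K = K, OF _ _ _ that])
    fix u assume u: "u \<in> traces"
    have "(\<integral>\<^sup>+v. ennreal (m (u \<odot> v)) \<partial>count_space (pyramids a 1)) = ennreal (m u)"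
      using nn_integral_cylinder_pyramids[OF u, of "\<lambda>x. ennreal (\<phi> x)" a] nn u pyramids_traces
      by (simp cong: nn_integral_cong_simp)
    then have m: "((\<lambda>v. m (u \<odot> v)) has_sum m u) (pyramids a 1)"
      using u m_nonneg pyramids_traces
      by (subst (asm) nn_integral_count_space_eq_iff_has_sum) auto
    have "((\<lambda>v. weight u * (weight v * h (u \<odot> v))) has_sum weight u * h u) (pyramids a 1)"
      by (intro has_sum_cmult_right harmonic_stopping[OF harm _ u, of K])
        (use bnd in \<open>simp add: abs_of_nonneg\<close>)
    then have "((\<lambda>v. weight (u \<odot> v) * h (u \<odot> v)) has_sum weight u * h u) (pyramids a 1)"
      by (rule has_sum_cong[THEN iffD1, rotated])
        (use u pyramids_traces in \<open>auto simp: weight_tmult\<close>)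
    from has_sum_add[OF m has_sum_uminusI[OF this]]
    show "((\<lambda>v. m (u \<odot> v) - weight (u \<odot> v) * h (u \<odot> v))
        has_sum m u - weight u * h u) (pyramids a 1)"
      by simp
    have "0 \<le> weight u * h u" "weight u * h u \<le> K * weight u"
      using bnd u mult_left_mono[OF bnd(2)[OF u], of "weight u"] by (auto simp: mult.commute)
    then show "\<bar>m u - weight u * h u\<bar> \<le> K * weight u"
      using m_le[OF u] m_nonneg[OF u] by linarith
  next
    show "m u - weight u * h u = 0" if "u \<in> pyramids a n" for n u
      using \<phi>(4)[OF that] by (simp add: m_def)
  qed
  then show thesis using that[OF \<phi>(1-3)] by (simp add: m_def)
qed

end

section \<open>The correspondence\<close>

lemma Linf_cases:
  assumes "\<phi> \<in> Linf M"
  obtains f where "f \<in> ess_bounded M" "\<phi> = Linf_rel M `` {f}"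
  using assms by (auto simp: Linf_def elim: quotientE)

lemma Linf_class_in: "f \<in> ess_bounded M \<Longrightarrow> Linf_rel M `` {f} \<in> Linf M"
  by (simp add: Linf_def quotientI)

lemma Linf_class_eq_iff:
  assumes "f \<in> ess_bounded M" "g \<in> ess_bounded M"
  shows "Linf_rel M `` {f} = Linf_rel M `` {g} \<longleftrightarrow> (AE x in M. f x = g x)"
  using eq_equiv_class_iff[OF equiv_Linf_rel assms] assms by (simp add: Linf_rel_def)

lemma Linf_class_self: "f \<in> ess_bounded M \<Longrightarrow> f \<in> Linf_rel M `` {f}"
  by (simp add: Linf_rel_def)

lemma ess_bounded_scale:
  assumes "f \<in> ess_bounded M" shows "(\<lambda>x. a * f x) \<in> ess_bounded M"
proof -
  obtain C where "f \<in> borel_measurable M" "AE x in M. \<bar>f x\<bar> \<le> C"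
    using assms by (auto simp: ess_bounded_def)
  moreover from this(2) have "AE x in M. \<bar>a * f x\<bar> \<le> \<bar>a\<bar> * C"
    by eventually_elim (simp add: abs_mult mult_left_mono)
  ultimately show ?thesis by (auto simp: ess_bounded_def)
qed

lemma ess_bounded_add:
  assumes "f \<in> ess_bounded M" "g \<in> ess_bounded M" shows "(\<lambda>x. f x + g x) \<in> ess_bounded M"
proof -
  obtain C D where "f \<in> borel_measurable M" "g \<in> borel_measurable M"
    and b: "AE x in M. \<bar>f x\<bar> \<le> C" "AE x in M. \<bar>g x\<bar> \<le> D"
    using assms by (auto simp: ess_bounded_def)
  moreover from b have "AE x in M. \<bar>f x + g x\<bar> \<le> C + D"
    by eventually_elim simp
  ultimately show ?thesis by (auto simp: ess_bounded_def)
qed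

lemma Linf_scale_class:
  assumes f: "f \<in> ess_bounded M"
  shows "Linf_scale M a (Linf_rel M `` {f}) = Linf_rel M `` {\<lambda>x. a * f x}"
proof -
  have "Linf_rel M `` {\<lambda>x. a * g x} = Linf_rel M `` {\<lambda>x. a * f x}" if "g \<in> Linf_rel M `` {f}" for g
  proof -
    have g: "g \<in> ess_bounded M" "AE x in M. f x = g x" using that by (auto simp: Linf_rel_def)
    from g(2) have "AE x in M. a * g x = a * f x" by eventually_elim simp
    then show ?thesis using f g by (simp add: Linf_class_eq_iff ess_bounded_scale)
  qed
  then show ?thesis unfolding Linf_scale_def using Linf_class_self[OF f] by blast
qed

lemma Linf_add_class:
  assumes f: "f \<in> ess_bounded M" and g: "g \<in> ess_bounded M"
  shows "Linf_add M (Linf_rel M `` {f}) (Linf_rel M `` {g}) = Linf_rel M `` {\<lambda>x. f x + g x}"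
proof -
  have "Linf_rel M `` {\<lambda>x. f' x + g' x} = Linf_rel M `` {\<lambda>x. f x + g x}"
    if "f' \<in> Linf_rel M `` {f}" "g' \<in> Linf_rel M `` {g}" for f' g'
  proof -
    have *: "f' \<in> ess_bounded M" "g' \<in> ess_bounded M" "AE x in M. f x = f' x" "AE x in M. g x = g' x"
      using that by (auto simp: Linf_rel_def)
    from *(3,4) have "AE x in M. f' x + g' x = f x + g x" by eventually_elim simp
    then show ?thesis using f g * by (simp add: Linf_class_eq_iff ess_bounded_add)
  qed
  then show ?thesis
    unfolding Linf_add_def using Linf_class_self[OF f] Linf_class_self[OF g] by blast
qed

context bernoulli
begin

lemma ess_bounded_integrable:
  assumes "f \<in> ess_bounded P" shows "integrable P f"
  using assms integrable_const_bound[of f] by (auto simp: ess_bounded_def)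

lemma set_integrable_cyl:
  assumes "f \<in> ess_bounded P" "u \<in> traces"
  shows "integrable P (\<lambda>x. indicator (cyl u) x *\<^sub>R f x)"
  using assms by (intro integrable_mult_indicator ess_bounded_integrable cyl_sets)

lemma set_integral_cyl_const:
  assumes "u \<in> traces" shows "(LINT x:cyl u|P. K :: real) = weight u * K"
  using assms cylinder_subset_boundary[of u]
  by (simp add: weight_def set_lebesgue_integral_def Int_absorb2 space_P)

lemma const_ess_bounded: "(\<lambda>x. K) \<in> ess_bounded P"
  by (auto simp: ess_bounded_def)

lemma set_integral_cyl_mono_AE:
  assumes "f \<in> ess_bounded P" "g \<in> ess_bounded P" "AE x in P. f x \<le> g x" "u \<in> traces"
  shows "(LINT x:cyl u|P. f x) \<le> (LINT x:cyl u|P. g x)"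
  unfolding set_lebesgue_integral_def
proof (rule integral_mono_AE)
  show "AE x in P. indicator (cyl u) x *\<^sub>R f x \<le> indicator (cyl u) x *\<^sub>R g x"
    using assms(3) by eventually_elim (auto simp: indicator_def)
qed (use assms set_integrable_cyl in auto)

lemma harmonic_of_class:
  assumes "f \<in> ess_bounded P" "u \<in> traces"
  shows "harmonic_of I P (Linf_rel P `` {f}) u = (LINT x:cyl u|P. f x) / weight u"
  using assms by (simp add: harmonic_of_def Linf_integral_class weight_def)

text \<open>Averages respect almost everywhere bounds. This gives boundedness of the image and one
  inequality of the isometry.\<close>

lemma abs_harmonic_of_class_le:
  assumes f: "f \<in> ess_bounded P" "AE x in P. \<bar>f x\<bar> \<le> C" and u: "u \<in> traces"
  shows "\<bar>harmonic_of I P (Linf_rel P `` {f}) u\<bar> \<le> C"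
proof -
  have "(LINT x:cyl u|P. f x) \<le> (LINT x:cyl u|P. C)"
    by (rule set_integral_cyl_mono_AE[OF f(1) const_ess_bounded _ u])
      (use f(2) in \<open>auto elim: eventually_mono\<close>)
  moreover have "(LINT x:cyl u|P. - C) \<le> (LINT x:cyl u|P. f x)"
    by (rule set_integral_cyl_mono_AE[OF const_ess_bounded f(1) _ u])
      (use f(2) in \<open>auto elim: eventually_mono\<close>)
  ultimately show ?thesis
    unfolding harmonic_of_class[OF f(1) u] set_integral_cyl_const[OF u]
    using weight_pos[OF u] by (auto simp: abs_le_iff field_simps)
qed

lemma harmonic_of_in_bounded_harmonic:
  assumes "\<phi> \<in> Linf P" shows "harmonic_of I P \<phi> \<in> bounded_harmonic I P"
proof -
  obtain f where f: "f \<in> ess_bounded P" "\<phi> = Linf_rel P `` {f}" using assms by (rule Linf_cases)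
  obtain C where C: "AE x in P. \<bar>f x\<bar> \<le> C" using f by (auto simp: ess_bounded_def)
  have "moebius_harmonic I P (harmonic_of I P \<phi>)"
    by (rule moebius_harmonic_average[OF ess_bounded_integrable[OF f(1)]])
      (use f weight_pos in \<open>auto simp: harmonic_of_class less_imp_neq[symmetric]\<close>)
  moreover have "bounded (harmonic_of I P \<phi> ` traces)"
    unfolding bounded_iff using abs_harmonic_of_class_le[OF f(1) C] f(2) by auto
  moreover have "harmonic_of I P \<phi> \<in> extensional traces"
    by (auto simp: harmonic_of_def)
  ultimately show ?thesis by (simp add: bounded_harmonic_def)
qed

lemma harmonic_of_inj:
  assumes "\<phi> \<in> Linf P" "\<psi> \<in> Linf P"
    and eq: "\<And>u. u \<in> traces \<Longrightarrow> harmonic_of I P \<phi> u = harmonic_of I P \<psi> u"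
  shows "\<phi> = \<psi>"
proof -
  obtain f where f: "f \<in> ess_bounded P" "\<phi> = Linf_rel P `` {f}" using assms(1) by (rule Linf_cases)
  obtain g where g: "g \<in> ess_bounded P" "\<psi> = Linf_rel P `` {g}" using assms(2) by (rule Linf_cases)
  have "(LINT x:cyl u|P. f x) = (LINT x:cyl u|P. g x)" if u: "u \<in> traces" for u
    using eq[OF u] weight_pos[OF u] u by (simp add: f g harmonic_of_class)
  then have "AE x in P. f x = g x"
    using f g by (intro AE_eq_if_cylinder_integrals_eq ess_bounded_integrable) auto
  then show ?thesis using f g by (simp add: Linf_class_eq_iff)
qed

lemma harmonic_of_class_eqI:
  assumes "g \<in> ess_bounded P" "(LINT x:cyl u|P. g x) = weight u * h u" "u \<in> traces"
  shows "harmonic_of I P (Linf_rel P `` {g}) u = h u"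
  using assms weight_pos[OF assms(3)] by (simp add: harmonic_of_class)

text \<open>Shifting by the constant \<open>K\<close>, which is harmonic, reduces to the nonnegative case.\<close>

lemma harmonic_of_surj:
  assumes harm: "moebius_harmonic I P h" and K: "\<And>u. u \<in> traces \<Longrightarrow> \<bar>h u\<bar> \<le> K"
  shows "\<exists>g\<in>ess_bounded P. (\<forall>x. \<bar>g x\<bar> \<le> K) \<and>
    (\<forall>u\<in>traces. harmonic_of I P (Linf_rel P `` {g}) u = h u)"
proof -
  have "moebius_harmonic I P (\<lambda>u. h u + K)"
    using moebius_harmonic_linear[OF harm moebius_harmonic_const[of K], of 1 1] by simp
  moreover have "0 \<le> h u + K" "h u + K \<le> 2 * K" if "u \<in> traces" for u
    using K[OF that] by (auto simp: abs_le_iff)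
  ultimately obtain \<phi> where \<phi>: "\<phi> \<in> borel_measurable P" "\<And>x. 0 \<le> \<phi> x" "\<And>x. \<phi> x \<le> 2 * K"
    "\<And>u. u \<in> traces \<Longrightarrow> (LINT x:cyl u|P. \<phi> x) = weight u * (h u + K)"
    using exists_density[of "\<lambda>u. h u + K" "2 * K"] by blast
  \<comment> \<open>As \<open>\<phi>\<close> lies between \<open>0\<close> and \<open>2 * K\<close>,
    undoing the shift gives a density with exactly the bound of \<open>h\<close>, as the isometry
    requires.\<close>
  define g where "g x = \<phi> x - K" for x
  have bnd: "\<bar>g x\<bar> \<le> K" for x using \<phi>(2,3)[of x] by (auto simp: g_def abs_le_iff)
  have g: "g \<in> ess_bounded P"
    using \<phi>(1) bnd unfolding ess_bounded_def g_def by auto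
  have \<phi>_ess: "\<phi> \<in> ess_bounded P"
    using \<phi>(1-3) unfolding ess_bounded_def by (auto intro!: exI[of _ "2 * K"])
  have "harmonic_of I P (Linf_rel P `` {g}) u = h u" if u: "u \<in> traces" for u
  proof (rule harmonic_of_class_eqI[OF g _ u])
    have "(LINT x:cyl u|P. g x) = (LINT x:cyl u|P. \<phi> x) - (LINT x:cyl u|P. K)"
      unfolding g_def set_lebesgue_integral_def
      using Bochner_Integration.integral_diff[OF set_integrable_cyl[OF \<phi>_ess u]
          set_integrable_cyl[OF const_ess_bounded[of K] u]]
      by (simp add: algebra_simps)
    then show "(LINT x:cyl u|P. g x) = weight u * h u"
      using u by (simp add: \<phi>(4) set_integral_cyl_const algebra_simps)
  qed
  then show ?thesis using g bnd by blast
qed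

lemma inj_on_harmonic_of: "inj_on (harmonic_of I P) (Linf P)"
  using harmonic_of_inj by (intro inj_onI) metis

lemma bij_betw_harmonic_of: "bij_betw (harmonic_of I P) (Linf P) (bounded_harmonic I P)"
proof (rule bij_betw_imageI[OF inj_on_harmonic_of], intro equalityI subsetI)
  fix h assume "h \<in> bounded_harmonic I P"
  then have h: "h \<in> extensional traces" "moebius_harmonic I P h" "bounded (h ` traces)"
    by (auto simp: bounded_harmonic_def)
  then obtain K where "\<And>u. u \<in> traces \<Longrightarrow> \<bar>h u\<bar> \<le> K" by (auto simp: bounded_iff)
  from harmonic_of_surj[OF h(2) this] obtain g where g: "g \<in> ess_bounded P"
    "\<And>u. u \<in> traces \<Longrightarrow> harmonic_of I P (Linf_rel P `` {g}) u = h u"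
    by blast
  have "harmonic_of I P (Linf_rel P `` {g}) = h"
    using g h(1) by (intro extensionalityI[of _ traces]) (auto simp: harmonic_of_def)
  then show "h \<in> harmonic_of I P ` Linf P" using Linf_class_in[OF g(1)] by blast
qed (auto intro: harmonic_of_in_bounded_harmonic)

lemma harmonic_of_linear:
  assumes "\<phi> \<in> Linf P" "\<psi> \<in> Linf P" and u: "u \<in> traces"
  shows "harmonic_of I P (Linf_add P (Linf_scale P a \<phi>) (Linf_scale P b \<psi>)) u
    = a * harmonic_of I P \<phi> u + b * harmonic_of I P \<psi> u"
proof -
  obtain f where f: "f \<in> ess_bounded P" "\<phi> = Linf_rel P `` {f}" using assms(1) by (rule Linf_cases)
  obtain g where g: "g \<in> ess_bounded P" "\<psi> = Linf_rel P `` {g}" using assms(2) by (rule Linf_cases)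
  have "(LINT x:cyl u|P. a * f x + b * g x) = a * (LINT x:cyl u|P. f x) + b * (LINT x:cyl u|P. g x)"
  proof -
    have "(LINT x:cyl u|P. a * f x + b * g x)
        = (LINT x|P. a * (indicator (cyl u) x *\<^sub>R f x) + b * (indicator (cyl u) x *\<^sub>R g x))"
      unfolding set_lebesgue_integral_def by (simp add: algebra_simps)
    also have "\<dots> = a * (LINT x:cyl u|P. f x) + b * (LINT x:cyl u|P. g x)"
      unfolding set_lebesgue_integral_def
      using set_integrable_cyl[OF f(1) u] set_integrable_cyl[OF g(1) u]
      by (subst Bochner_Integration.integral_add) (simp_all del: mult_scaleR_right)
    finally show ?thesis .
  qed
  then show ?thesis
    using f g u
    by (simp add: Linf_scale_class Linf_add_class ess_bounded_scale ess_bounded_add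
        harmonic_of_class add_divide_distrib)
qed

text \<open>With \<open>K\<close> the sup norm of \<open>h\<close>, surjectivity yields a
  representative bounded by \<open>K\<close>, and injectivity places it in the class
  \<open>\<phi>\<close>; so the essential supremum is at most \<open>K\<close>. Averaging gives the
  converse.\<close>

lemma trace_sup_norm_harmonic_of:
  assumes "\<phi> \<in> Linf P" shows "trace_sup_norm I (harmonic_of I P \<phi>) = Linf_norm P \<phi>"
proof -
  obtain f where f: "f \<in> ess_bounded P" "\<phi> = Linf_rel P `` {f}" using assms by (rule Linf_cases)
  then have [measurable]: "f \<in> borel_measurable P" by (simp add: ess_bounded_def)
  define h where "h = harmonic_of I P \<phi>"
  define K where "K = trace_sup_norm I h"
  define e where "e = esssup P (\<lambda>x. ereal \<bar>f x\<bar>)"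
  have h: "moebius_harmonic I P h" "bounded (h ` traces)"
    using harmonic_of_in_bounded_harmonic[OF assms] by (auto simp: h_def bounded_harmonic_def)
  then have bdd: "bdd_above ((\<lambda>u. \<bar>h u\<bar>) ` traces)"
    by (auto simp: bounded_iff bdd_above_def)
  have ne: "traces \<noteq> {}" using tr_in_traces by blast
  have h_le: "\<bar>h u\<bar> \<le> K" if "u \<in> traces" for u
    unfolding K_def trace_sup_norm_def using that by (intro cSUP_upper bdd)
  from harmonic_of_surj[OF h(1) h_le]
  obtain g where g: "g \<in> ess_bounded P" "\<And>x. \<bar>g x\<bar> \<le> K"
    "\<And>u. u \<in> traces \<Longrightarrow> harmonic_of I P (Linf_rel P `` {g}) u = h u"
    by blast
  have "\<phi> = Linf_rel P `` {g}"
    using g by (intro harmonic_of_inj assms Linf_class_in) (auto simp: h_def)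
  then have "AE x in P. f x = g x" using f Linf_class_eq_iff[OF f(1) g(1)] by simp
  then have "AE x in P. ereal \<bar>f x\<bar> \<le> ereal K" by eventually_elim (simp add: g(2))
  then have e_le: "e \<le> ereal K" unfolding e_def by (intro esssup_I) auto
  \<comment> \<open>Together with \<open>e_le\<close> this makes \<open>e\<close> finite, so
    \<open>real_of_ereal\<close> in the norm loses nothing.\<close>
  have "esssup P (\<lambda>x. 0) \<le> e" unfolding e_def by (rule esssup_mono) auto
  then have "0 \<le> e" by (simp add: esssup_const emeasure_space_1)
  then obtain c where c: "e = ereal c" using e_le by (cases e) auto
  have "AE x in P. \<bar>f x\<bar> \<le> c"
    using esssup_AE[of "\<lambda>x. ereal \<bar>f x\<bar>" P] unfolding e_def[symmetric] c by simp
  then have "\<bar>h u\<bar> \<le> c" if "u \<in> traces" for u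
    using abs_harmonic_of_class_le[OF f(1) _ that] by (simp add: h_def f(2))
  then have "K \<le> c" unfolding K_def trace_sup_norm_def by (intro cSUP_least ne)
  then have "K = c" using e_le c by simp
  then show ?thesis
    using Linf_norm_class[OF f(1)] c by (simp add: K_def h_def f(2) e_def)
qed

lemma harmonic_of_nonneg:
  assumes "\<phi> \<in> Linf P" "Linf_nonneg P \<phi>" "u \<in> traces"
  shows "0 \<le> harmonic_of I P \<phi> u"
proof -
  obtain g where g: "g \<in> \<phi>" "AE x in P. 0 \<le> g x" using assms(2) by (auto simp: Linf_nonneg_def)
  obtain f where f: "f \<in> ess_bounded P" "\<phi> = Linf_rel P `` {f}" using assms(1) by (rule Linf_cases)
  have "(f, g) \<in> Linf_rel P" using f g by simp
  then have "g \<in> ess_bounded P" and eq: "AE x in P. f x = g x" by (auto simp: Linf_rel_def)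
  have "AE x in P. 0 \<le> f x" using eq g(2) by eventually_elim simp
  from set_integral_cyl_mono_AE[OF const_ess_bounded f(1) this assms(3)]
  show ?thesis
    using f assms(3) by (simp add: harmonic_of_class set_integral_cyl_const)
qed

text \<open>Goes back to the unshifted density, which is nonnegative by construction; the one from
  \<open>harmonic_of_surj\<close> is only known to be bounded in absolute value.\<close>

lemma inv_harmonic_of_nonneg:
  assumes h: "h \<in> bounded_harmonic I P" and nonneg: "\<And>u. u \<in> traces \<Longrightarrow> 0 \<le> h u"
  shows "Linf_nonneg P (inv_into (Linf P) (harmonic_of I P) h)"
proof -
  have harm: "moebius_harmonic I P h" and ext: "h \<in> extensional traces" and "bounded (h ` traces)"
    using h by (auto simp: bounded_harmonic_def)
  then obtain K where "\<And>u. u \<in> traces \<Longrightarrow> \<bar>h u\<bar> \<le> K" by (auto simp: bounded_iff)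
  then have K: "h u \<le> K" if "u \<in> traces" for u using that abs_le_D1 by blast
  obtain g where g: "g \<in> borel_measurable P" "\<And>x. 0 \<le> g x" "\<And>x. g x \<le> K"
    "\<And>u. u \<in> traces \<Longrightarrow> (LINT x:cyl u|P. g x) = weight u * h u"
    using exists_density[OF harm nonneg K] by blast
  have ess: "g \<in> ess_bounded P"
    using g(1-3) unfolding ess_bounded_def by (auto intro!: exI[of _ K])
  have "harmonic_of I P (Linf_rel P `` {g}) = h"
    using ext harmonic_of_class_eqI[of g _ h, OF ess g(4)]
    by (intro extensionalityI[of _ traces]) (auto simp: harmonic_of_def)
  then have "inv_into (Linf P) (harmonic_of I P) h = Linf_rel P `` {g}"
    using inv_into_f_f[OF inj_on_harmonic_of Linf_class_in[OF ess]] by simp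
  then show ?thesis
    using Linf_class_self[OF ess] g(2) by (auto simp: Linf_nonneg_def)
qed

end

theorem theorem2:
  fixes I :: "('a::finite \<times> 'a) set" and P :: "'a gen_trace measure"
  assumes "CARD('a) > 1" and "sym I" and "irrefl I"
    and "irreducible_trace_monoid I"
    and "bernoulli_measure I P"
  shows
    "(\<forall>h. moebius_harmonic I P h \<and> bounded (h ` carrier (trace_monoid I)) \<longrightarrow>
           (\<exists>!\<phi>. \<phi> \<in> Linf P \<and>
              (\<forall>u\<in>carrier (trace_monoid I).
                 h u = 1 / measure P (cylinder I u) * Linf_integral P (cylinder I u) \<phi>))) \<and>
     bij_betw (harmonic_of I P) (Linf P) (bounded_harmonic I P) \<and>
     (\<forall>\<phi>\<in>Linf P. \<forall>\<psi>\<in>Linf P. \<forall>a b. \<forall>u\<in>carrier (trace_monoid I).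
           harmonic_of I P (Linf_add P (Linf_scale P a \<phi>) (Linf_scale P b \<psi>)) u
             = a * harmonic_of I P \<phi> u + b * harmonic_of I P \<psi> u) \<and>
     (\<forall>\<phi>\<in>Linf P. trace_sup_norm I (harmonic_of I P \<phi>) = Linf_norm P \<phi>) \<and>
     (\<forall>\<phi>\<in>Linf P. Linf_nonneg P \<phi> \<longrightarrow>
           (\<forall>u\<in>carrier (trace_monoid I). 0 \<le> harmonic_of I P \<phi> u)) \<and>
     (\<forall>h\<in>bounded_harmonic I P. (\<forall>u\<in>carrier (trace_monoid I). 0 \<le> h u) \<longrightarrow>
           Linf_nonneg P (inv_into (Linf P) (harmonic_of I P) h))"
proof -
  interpret bernoulli I P
    by unfold_locales (use assms in auto)
  have "\<exists>!\<phi>. \<phi> \<in> Linf P \<and>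
      (\<forall>u\<in>traces. h u = 1 / measure P (cyl u) * Linf_integral P (cyl u) \<phi>)"
    if h: "moebius_harmonic I P h" "bounded (h ` traces)" for h
  proof -
    \<comment> \<open>Here \<open>h\<close> is arbitrary off the monoid, whereas
      \<open>harmonic_of\<close> is extensional, so the two are compared on traces only.\<close>
    have eq: "1 / measure P (cyl u) * Linf_integral P (cyl u) \<phi> = harmonic_of I P \<phi> u"
      if "u \<in> traces" for u \<phi>
      using that by (simp add: harmonic_of_def)
    obtain K where "\<And>u. u \<in> traces \<Longrightarrow> \<bar>h u\<bar> \<le> K" using h(2) by (auto simp: bounded_iff)
    from harmonic_of_surj[OF h(1) this] obtain g where "g \<in> ess_bounded P"
      "\<And>u. u \<in> traces \<Longrightarrow> harmonic_of I P (Linf_rel P `` {g}) u = h u"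
      by blast
    then have "\<exists>\<phi>. \<phi> \<in> Linf P \<and> (\<forall>u\<in>traces. h u = harmonic_of I P \<phi> u)"
      using Linf_class_in by (intro exI[of _ "Linf_rel P `` {g}"]) auto
    then have "\<exists>!\<phi>. \<phi> \<in> Linf P \<and> (\<forall>u\<in>traces. h u = harmonic_of I P \<phi> u)"
      by (rule ex_ex1I) (metis harmonic_of_inj)
    then show ?thesis by (simp only: eq cong: ball_cong)
  qed
  then show ?thesis
    by (intro conjI allI ballI impI bij_betw_harmonic_of harmonic_of_linear
        trace_sup_norm_harmonic_of harmonic_of_nonneg inv_harmonic_of_nonneg) simp_all
qed


end
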